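(* Let $d,n,m\in\mathbb{N}$ with $d\geq2$, let $p_1,p_2\in[0,1]$, and let $W_{p_1},W_{p_2}:\mathcal{M}_d\to\mathcal{M}_d$ be the Werner maps with these parameters. Then the map $W_{p_1}^{\otimes n}\otimes(\vartheta_d\circ W_{p_2})^{\otimes m}$ is decomposable if and only if the value of the following linear program is nonnegative: minimize $\langle v^n_{p_1}|Q|v^m_{p_2}\rangle$ over real matrices $Q\in\mathcal{M}_{n+1,m+1}(\mathbb{R})$ subject to $$(QV^m_d)_{ij}\geq0\quad\text{and}\quad(Q^TV^n_d)_{ji}\geq0\quad\text{for all }i\in\{1,\dots,n+1\},\ j\in\{1,\dots,m+1\},$$ $$\sum_{k=1}^{n+1}\sum_{l=1}^{m+1}Q_{kl}=1.$$
   Context: $\mathcal{M}_d$ denotes the complex $d\times d$ matrices, $\mathcal{M}_{n,m}(\mathbb{R})$ the real $n\times m$ matrices, and $\vartheta_d$ the transposition on $\mathcal{M}_d$ in the computational basis. A linear map $L:\mathcal{M}_{D}\to\mathcal{M}_{D'}$ is decomposable if $L=T_1+\vartheta_{D'}\circ T_2$ with $T_1,T_2$ completely positive; here $\mathcal{M}_d^{\otimes(n+m)}\cong\mathcal{M}_{d^{n+m}}$. The Choi matrix of $L:\mathcal{M}_d\to\mathcal{M}_d$ is $C_L=(\mathrm{id}_d\otimes L)(\omega_d)$ with $\omega_d=\sum_{i,j}|i\rangle\langle j|\otimes|i\rangle\langle j|$. With the flip $\mathbb{F}_d(|i\rangle\otimes|j\rangle)=|j\rangle\otimes|i\rangle$,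 set $P_{\mathrm{sym}}=\frac12(\mathbb{1}_d\otimes\mathbb{1}_d+\mathbb{F}_d)$, $P_{\mathrm{asym}}=\frac12(\mathbb{1}_d\otimes\mathbb{1}_d-\mathbb{F}_d)$, $d_{\mathrm{sym}}=d(d+1)/2$, $d_{\mathrm{asym}}=d(d-1)/2$. The Werner map $W_p$, $p\in[0,1]$, is the linear map with Choi matrix $C_{W_p}=p\,P_{\mathrm{sym}}/d_{\mathrm{sym}}+(1-p)\,P_{\mathrm{asym}}/d_{\mathrm{asym}}$. For $n\in\mathbb{N}$ and $p\in[0,1]$, $|v^n_p\rangle\in\mathbb{R}^{n+1}$ has entries $(|v^n_p\rangle)_k=\big(\frac{d+1}{d-1}\big)^{k-1}(1-p)^{k-1}p^{n-k+1}$ for $k=1,\dots,n+1$ (with $0^0=1$), and $\langle v^n_p|$ is its transpose. For $m\in\mathbb{N}$, $V^m_d$ is the $(m+1)\times(m+1)$ matrix with entries $$(V^m_d)_{ab}=(-1)^{a-1}\sum_{t=\max(0,a+b-m-2)}^{\min(a-1,b-1)}\binom{a-1}{t}\binom{m-a+1}{b-t-1}\Big(-\frac{d+1}{d-1}\Big)^t,\qquad a,b\in\{1,\dots,m+1\}.$$ *)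

theory Defs
  imports
    Complex_Main
    "HOL-Library.Extended_Real"
    "HOL-Library.Complex_Order"
    "Jordan_Normal_Form.Matrix"
begin

section \<open>Linear maps between matrix algebras\<close>

text \<open>A linear map from the $D \times D$ to the $D' \times D'$ matrices is a HOL function on
  \<^typ>\<open>complex mat\<close>; its values outside \<^term>\<open>carrier_mat D D\<close> are irrelevant
  in everything below.\<close>

definition linear_map :: "nat \<Rightarrow> nat \<Rightarrow> (complex mat \<Rightarrow> complex mat) \<Rightarrow> bool" where
  "linear_map D D' L \<longleftrightarrow>
     (\<forall>X \<in> carrier_mat D D. L X \<in> carrier_mat D' D') \<and>
     (\<forall>X \<in> carrier_mat D D. \<forall>Y \<in> carrier_mat D D. L (X + Y) = L X + L Y) \<and>
     (\<forall>c. \<forall>X \<in> carrier_mat D D. L (c \<cdot>\<^sub>m X) = c \<cdot>\<^sub>m L X)"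

definition matrix_unit :: "nat \<Rightarrow> nat \<Rightarrow> nat \<Rightarrow> complex mat" where
  "matrix_unit d i j = mat d d (\<lambda>(r, c). if r = i \<and> c = j then 1 else 0)"

text \<open>Kronecker product: the basis vector $|i\rangle \otimes |k\rangle$ has index
  $i \cdot d_2 + k$, where $d_2$ is the dimension of the second factor.\<close>

definition kronecker :: "complex mat \<Rightarrow> complex mat \<Rightarrow> complex mat" where
  "kronecker A B = mat (dim_row A * dim_row B) (dim_col A * dim_col B)
     (\<lambda>(r, c). A $$ (r div dim_row B, c div dim_col B) * B $$ (r mod dim_row B, c mod dim_col B))"

text \<open>The tensor product of $L_1 : M_{d_1} \to M_{e_1}$ and $L_2 : M_{d_2} \to M_{e_2}$,
  obtained by expanding the argument in the basis $E_{ij} \otimes E_{kl}$. Lemma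
  \<open>tensor_map_kronecker\<close> below gives the usual characterization.\<close>

definition tensor_map ::
  "nat \<Rightarrow> nat \<Rightarrow> (complex mat \<Rightarrow> complex mat) \<Rightarrow> nat \<Rightarrow> nat \<Rightarrow> (complex mat \<Rightarrow> complex mat) \<Rightarrow>
   complex mat \<Rightarrow> complex mat" where
  "tensor_map d1 e1 L1 d2 e2 L2 X = mat (e1 * e2) (e1 * e2) (\<lambda>rc.
     \<Sum>i<d1. \<Sum>j<d1. \<Sum>k<d2. \<Sum>l<d2. X $$ (i * d2 + k, j * d2 + l) *
       kronecker (L1 (matrix_unit d1 i j)) (L2 (matrix_unit d2 k l)) $$ rc)"

text \<open>$L^{\otimes n}$ for $L : M_d \to M_d$; the empty power is the identity of $M_1$.\<close>

fun tensor_power :: "nat \<Rightarrow> (complex mat \<Rightarrow> complex mat) \<Rightarrow> nat \<Rightarrow> complex mat \<Rightarrow> complex mat" where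
  "tensor_power d L 0 = id"
| "tensor_power d L (Suc n) = tensor_map d d L (d ^ n) (d ^ n) (tensor_power d L n)"

text \<open>In the order on \<^typ>\<open>complex\<close>, nonnegativity includes being real, so the matrices
  below are Hermitian.\<close>

definition positive_semidefinite :: "nat \<Rightarrow> complex mat \<Rightarrow> bool" where
  "positive_semidefinite D A \<longleftrightarrow>
     A \<in> carrier_mat D D \<and> (\<forall>x \<in> carrier_vec D. 0 \<le> (A *\<^sub>v x) \<bullet>c x)"

definition completely_positive :: "nat \<Rightarrow> nat \<Rightarrow> (complex mat \<Rightarrow> complex mat) \<Rightarrow> bool" where
  "completely_positive D D' L \<longleftrightarrow> linear_map D D' L \<and>
     (\<forall>k X. positive_semidefinite (k * D) X \<longrightarrow>
        positive_semidefinite (k * D') (tensor_map k k id D D' L X))"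

definition decomposable :: "nat \<Rightarrow> nat \<Rightarrow> (complex mat \<Rightarrow> complex mat) \<Rightarrow> bool" where
  "decomposable D D' L \<longleftrightarrow> linear_map D D' L \<and>
     (\<exists>T1 T2. completely_positive D D' T1 \<and> completely_positive D D' T2 \<and>
        (\<forall>X \<in> carrier_mat D D. L X = T1 X + transpose_mat (T2 X)))"


section \<open>Werner maps\<close>

definition omega :: "nat \<Rightarrow> complex mat" where
  "omega d = mat (d * d) (d * d)
     (\<lambda>rc. \<Sum>i<d. \<Sum>j<d. kronecker (matrix_unit d i j) (matrix_unit d i j) $$ rc)"

definition choi_matrix :: "nat \<Rightarrow> (complex mat \<Rightarrow> complex mat) \<Rightarrow> complex mat" where
  "choi_matrix d L = tensor_map d d id d d L (omega d)"

text \<open>Column $c = i \cdot d + j$ represents $|i\rangle \otimes |j\rangle$; its image is the basis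
  vector with index $j \cdot d + i$.\<close>

definition flip_matrix :: "nat \<Rightarrow> complex mat" where
  "flip_matrix d = mat (d * d) (d * d)
     (\<lambda>(r, c). if r = (c mod d) * d + c div d then 1 else 0)"

definition P_sym :: "nat \<Rightarrow> complex mat" where
  "P_sym d = (1 / 2) \<cdot>\<^sub>m (1\<^sub>m (d * d) + flip_matrix d)"

definition P_asym :: "nat \<Rightarrow> complex mat" where
  "P_asym d = (1 / 2) \<cdot>\<^sub>m (1\<^sub>m (d * d) - flip_matrix d)"

definition d_sym :: "nat \<Rightarrow> real" where
  "d_sym d = real d * (real d + 1) / 2"

definition d_asym :: "nat \<Rightarrow> real" where
  "d_asym d = real d * (real d - 1) / 2"

definition werner_choi :: "nat \<Rightarrow> real \<Rightarrow> complex mat" where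
  "werner_choi d p = complex_of_real (p / d_sym d) \<cdot>\<^sub>m P_sym d
     + complex_of_real ((1 - p) / d_asym d) \<cdot>\<^sub>m P_asym d"

text \<open>\<open>is_werner_map d p W\<close> states that \<open>W\<close> is the Werner map with parameter \<open>p\<close>. Such a map
  exists and is determined on \<^term>\<open>carrier_mat d d\<close>: see \<open>ex_werner_map\<close> and
  \<open>werner_map_unique\<close> below.\<close>

definition is_werner_map :: "nat \<Rightarrow> real \<Rightarrow> (complex mat \<Rightarrow> complex mat) \<Rightarrow> bool" where
  "is_werner_map d p W \<longleftrightarrow> linear_map d d W \<and> choi_matrix d W = werner_choi d p"


section \<open>The linear program\<close>

text \<open>Vector and matrix indices start at 0, so entry \<open>k\<close> of \<open>v_vec\<close> and entry \<open>(a, b)\<close> of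
  \<open>V_mat\<close> are the entries $k+1$ and $(a+1, b+1)$ in one-based notation. The truncated
  subtraction in \<open>a + b - m\<close> supplies the lower summation bound $\max(0, a + b - m)$.\<close>

definition v_vec :: "nat \<Rightarrow> nat \<Rightarrow> real \<Rightarrow> real vec" where
  "v_vec d n p = vec (n + 1)
     (\<lambda>k. ((real d + 1) / (real d - 1)) ^ k * (1 - p) ^ k * p ^ (n - k))"

definition V_mat :: "nat \<Rightarrow> nat \<Rightarrow> real mat" where
  "V_mat d m = mat (m + 1) (m + 1) (\<lambda>(a, b).
     (- 1) ^ a * (\<Sum>t = a + b - m..min a b.
        real (a choose t) * real ((m - a) choose (b - t)) * (- ((real d + 1) / (real d - 1))) ^ t))"

definition lp_feasible :: "nat \<Rightarrow> nat \<Rightarrow> nat \<Rightarrow> real mat set" where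
  "lp_feasible d n m = {Q \<in> carrier_mat (n + 1) (m + 1).
     (\<forall>i<n + 1. \<forall>j<m + 1. (Q * V_mat d m) $$ (i, j) \<ge> 0 \<and>
        (transpose_mat Q * V_mat d n) $$ (j, i) \<ge> 0) \<and>
     (\<Sum>k<n + 1. \<Sum>l<m + 1. Q $$ (k, l)) = 1}"

definition lp_value :: "nat \<Rightarrow> nat \<Rightarrow> nat \<Rightarrow> real \<Rightarrow> real \<Rightarrow> ereal" where
  "lp_value d n m p1 p2 =
     (INF Q \<in> lp_feasible d n m. ereal (v_vec d n p1 \<bullet> (Q *\<^sub>v v_vec d m p2)))"


section \<open>Tensor products and Choi matrices behave as expected\<close>

lemma sum2_delta:
  fixes f :: "nat \<Rightarrow> nat \<Rightarrow> complex"
  assumes "i < d" "j < d"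
  shows "(\<Sum>a<d. \<Sum>b<d. (if a = i \<and> b = j then 1 else 0) * f a b) = f i j"
    and "(\<Sum>a<d. \<Sum>b<d. (if i = a \<and> j = b then 1 else 0) * f a b) = f i j"
proof -
  have "(\<Sum>a<d. \<Sum>b<d. (if a = i \<and> b = j then 1 else 0) * f a b)
    = (\<Sum>a<d. if a = i then \<Sum>b<d. if b = j then f a b else 0 else 0)"
    by (intro sum.cong refl) (simp add: if_distrib[of "\<lambda>x. x * _"] cong: if_cong)
  also have "\<dots> = f i j"
    using assms by (simp only: sum.delta finite_lessThan lessThan_iff if_True)
  finally show *: "(\<Sum>a<d. \<Sum>b<d. (if a = i \<and> b = j then 1 else 0) * f a b) = f i j" .
  then show "(\<Sum>a<d. \<Sum>b<d. (if i = a \<and> j = b then 1 else 0) * f a b) = f i j"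
    by (simp add: eq_commute[of i] eq_commute[of j])
qed

lemma linear_map_zero:
  assumes "linear_map D D' L" shows "L (0\<^sub>m D D) = 0\<^sub>m D' D'"
proof -
  have c: "L (0\<^sub>m D D) \<in> carrier_mat D' D'" using assms by (auto simp: linear_map_def)
  have "L (0 \<cdot>\<^sub>m 0\<^sub>m D D) = 0 \<cdot>\<^sub>m L (0\<^sub>m D D)"
    using assms zero_carrier_mat[of D D] unfolding linear_map_def by blast
  moreover have "(0::complex) \<cdot>\<^sub>m 0\<^sub>m D D = 0\<^sub>m D D" by (rule eq_matI) auto
  moreover have "0 \<cdot>\<^sub>m L (0\<^sub>m D D) = 0\<^sub>m D' D'" using c by (intro eq_matI) auto
  ultimately show ?thesis by simp
qed

lemma linear_map_sum_entry:
  assumes L: "linear_map D D' L" and "finite S" and r: "r < D'" and c: "c < D'"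
    and F: "\<And>s. s \<in> S \<Longrightarrow> F s \<in> carrier_mat D D"
  shows "L (mat D D (\<lambda>rc. \<Sum>s\<in>S. g s * F s $$ rc)) $$ (r, c) = (\<Sum>s\<in>S. g s * L (F s) $$ (r, c))"
  using \<open>finite S\<close> F
proof (induction S rule: finite_induct)
  case empty
  have "mat D D (\<lambda>rc. \<Sum>s\<in>{}. g s * F s $$ rc) = 0\<^sub>m D D" by (rule eq_matI) auto
  then show ?case using linear_map_zero[OF L] r c by simp
next
  case (insert x S)
  let ?M = "mat D D (\<lambda>rc. \<Sum>s\<in>S. g s * F s $$ rc)"
  have x: "F x \<in> carrier_mat D D" using insert by auto
  have "mat D D (\<lambda>rc. \<Sum>s\<in>insert x S. g s * F s $$ rc) = g x \<cdot>\<^sub>m F x + ?M"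
    using insert.hyps x carrier_matD[OF x] by (intro eq_matI) (auto simp del: carrier_matD)
  moreover have "L (g x \<cdot>\<^sub>m F x + ?M) = g x \<cdot>\<^sub>m L (F x) + L ?M"
  proof -
    have "g x \<cdot>\<^sub>m F x \<in> carrier_mat D D" using x by simp
    moreover have "?M \<in> carrier_mat D D" by simp
    ultimately have "L (g x \<cdot>\<^sub>m F x + ?M) = L (g x \<cdot>\<^sub>m F x) + L ?M"
      using L unfolding linear_map_def by blast
    moreover have "L (g x \<cdot>\<^sub>m F x) = g x \<cdot>\<^sub>m L (F x)"
      using L x unfolding linear_map_def by blast
    ultimately show ?thesis by simp
  qed
  moreover have "L (F x) \<in> carrier_mat D' D'" "L ?M \<in> carrier_mat D' D'"
    using L x unfolding linear_map_def by auto
  moreover have "L ?M $$ (r, c) = (\<Sum>s\<in>S. g s * L (F s) $$ (r, c))"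
    using insert by blast
  ultimately show ?case using insert.hyps r c by simp
qed

lemma linear_map_entry:
  assumes L: "linear_map D D' L" and X: "X \<in> carrier_mat D D" and r: "r < D'" and c: "c < D'"
  shows "L X $$ (r, c) = (\<Sum>i<D. \<Sum>j<D. X $$ (i, j) * L (matrix_unit D i j) $$ (r, c))"
proof -
  let ?S = "{..<D} \<times> {..<D}"
  have "mat D D (\<lambda>rc. \<Sum>s\<in>?S. X $$ s * (case s of (i, j) \<Rightarrow> matrix_unit D i j) $$ rc) = X"
  proof (rule eq_matI)
    fix a b assume "a < dim_row X" "b < dim_col X"
    then have ab: "a < D" "b < D" using X by auto
    have "(\<Sum>s\<in>?S. X $$ s * (case s of (i, j) \<Rightarrow> matrix_unit D i j) $$ (a, b))
      = (\<Sum>i<D. \<Sum>j<D. (if i = a \<and> j = b then 1 else 0) * X $$ (i, j))"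
      unfolding sum.cartesian_product using ab by (intro sum.cong) (auto simp: matrix_unit_def)
    also have "\<dots> = X $$ (a, b)" using ab by (rule sum2_delta)
    finally show "mat D D (\<lambda>rc. \<Sum>s\<in>?S. X $$ s * (case s of (i, j) \<Rightarrow> matrix_unit D i j) $$ rc)
      $$ (a, b) = X $$ (a, b)" using ab by simp
  qed (use X in auto)
  moreover have "L (mat D D (\<lambda>rc. \<Sum>s\<in>?S. X $$ s * (case s of (i, j) \<Rightarrow> matrix_unit D i j) $$ rc)) $$ (r, c)
     = (\<Sum>s\<in>?S. X $$ s * L (case s of (i, j) \<Rightarrow> matrix_unit D i j) $$ (r, c))"
    by (rule linear_map_sum_entry[OF L]) (use r c in \<open>auto simp: matrix_unit_def\<close>)
  ultimately show ?thesis by (simp add: sum.cartesian_product case_prod_unfold)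
qed

lemma index_bound: "i < d1 \<Longrightarrow> k < d2 \<Longrightarrow> i * d2 + k < d1 * (d2 :: nat)"
proof -
  assume "i < d1" "k < d2"
  then have "i * d2 + k < Suc i * d2" by simp
  also have "\<dots> \<le> d1 * d2" using \<open>i < d1\<close> by (intro mult_le_mono1) simp
  finally show ?thesis .
qed

lemma index_split: "r < e1 * (e2 :: nat) \<Longrightarrow> r div e2 < e1 \<and> r mod e2 < e2"
  by (cases "e2 = 0") (simp_all add: less_mult_imp_div_less)

lemma tensor_map_kronecker:
  assumes L1: "linear_map d1 e1 L1" and L2: "linear_map d2 e2 L2"
    and A: "A \<in> carrier_mat d1 d1" and B: "B \<in> carrier_mat d2 d2"
  shows "tensor_map d1 e1 L1 d2 e2 L2 (kronecker A B) = kronecker (L1 A) (L2 B)"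
proof (rule eq_matI)
  have LA: "L1 A \<in> carrier_mat e1 e1" and LB: "L2 B \<in> carrier_mat e2 e2"
    using assms unfolding linear_map_def by auto
  {
    fix r c assume "r < dim_row (kronecker (L1 A) (L2 B))" "c < dim_col (kronecker (L1 A) (L2 B))"
    then have r: "r < e1 * e2" and c: "c < e1 * e2" using LA LB by (auto simp: kronecker_def)
    define r1 r2 c1 c2 where "r1 = r div e2" "r2 = r mod e2" "c1 = c div e2" "c2 = c mod e2"
    note bd = index_split[OF r] index_split[OF c]
    have K: "kronecker A B $$ (i * d2 + k, j * d2 + l) = A $$ (i, j) * B $$ (k, l)"
      if "i < d1" "j < d1" "k < d2" "l < d2" for i j k l
      using that A B by (auto simp: kronecker_def index_bound)
    have U: "kronecker (L1 (matrix_unit d1 i j)) (L2 (matrix_unit d2 k l)) $$ (r, c)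
      = L1 (matrix_unit d1 i j) $$ (r1, c1) * L2 (matrix_unit d2 k l) $$ (r2, c2)" for i j k l
    proof -
      have "L1 (matrix_unit d1 i j) \<in> carrier_mat e1 e1" "L2 (matrix_unit d2 k l) \<in> carrier_mat e2 e2"
        using L1 L2 unfolding linear_map_def by (auto simp: matrix_unit_def)
      then show ?thesis using r c by (auto simp: kronecker_def r1_r2_c1_c2_def)
    qed
    have "tensor_map d1 e1 L1 d2 e2 L2 (kronecker A B) $$ (r, c) =
      (\<Sum>i<d1. \<Sum>j<d1. \<Sum>k<d2. \<Sum>l<d2. (A $$ (i, j) * L1 (matrix_unit d1 i j) $$ (r1, c1)) *
         (B $$ (k, l) * L2 (matrix_unit d2 k l) $$ (r2, c2)))"
      using r c by (simp add: tensor_map_def K U mult_ac)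
    also have "\<dots> = L1 A $$ (r1, c1) * L2 B $$ (r2, c2)"
      using bd by (simp add: linear_map_entry[OF L1 A] linear_map_entry[OF L2 B] r1_r2_c1_c2_def
         sum_distrib_left sum_distrib_right) (simp add: sum_distrib_left[symmetric] sum_distrib_right[symmetric])
    also have "\<dots> = kronecker (L1 A) (L2 B) $$ (r, c)"
      using r c LA LB by (auto simp: kronecker_def r1_r2_c1_c2_def)
    finally show "tensor_map d1 e1 L1 d2 e2 L2 (kronecker A B) $$ (r, c)
      = kronecker (L1 A) (L2 B) $$ (r, c)" .
  }
  show "dim_row (tensor_map d1 e1 L1 d2 e2 L2 (kronecker A B)) = dim_row (kronecker (L1 A) (L2 B))"
    and "dim_col (tensor_map d1 e1 L1 d2 e2 L2 (kronecker A B)) = dim_col (kronecker (L1 A) (L2 B))"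
    using carrier_matD[OF LA] carrier_matD[OF LB] by (simp_all add: tensor_map_def kronecker_def)
qed

lemma omega_entry:
  assumes "i < d" "j < d" "k < d" "l < d"
  shows "omega d $$ (i * d + k, j * d + l) = (if i = k \<and> j = l then 1 else 0)"
proof -
  have "omega d $$ (i * d + k, j * d + l)
    = (\<Sum>a<d. \<Sum>b<d. if a = i \<and> b = j \<and> i = k \<and> j = l then 1 else 0)"
    unfolding omega_def using assms
    by (auto simp: kronecker_def matrix_unit_def index_bound intro!: sum.cong)
  also have "\<dots> = (\<Sum>a<d. if a = i then (\<Sum>b<d. if b = j then (if i = k \<and> j = l then 1 else 0) else 0) else 0)"
    by (intro sum.cong) (auto intro!: sum.cong)
  also have "\<dots> = (if i = k \<and> j = l then 1 else 0)"
    using assms by (simp only: sum.delta finite_lessThan lessThan_iff if_True)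
  finally show ?thesis .
qed

lemma choi_matrix_entry:
  assumes L: "linear_map d d L" and "i < d" "j < d" "k < d" "l < d"
  shows "choi_matrix d L $$ (i * d + k, j * d + l) = L (matrix_unit d i j) $$ (k, l)"
proof -
  have LU: "L (matrix_unit d a b) \<in> carrier_mat d d" for a b
    using L unfolding linear_map_def by (auto simp: matrix_unit_def)
  have "choi_matrix d L $$ (i * d + k, j * d + l) =
    (\<Sum>a<d. \<Sum>b<d. \<Sum>x<d. \<Sum>y<d. (if a = x \<and> b = y then 1 else 0) *
       ((if i = a \<and> j = b then 1 else 0) * L (matrix_unit d x y) $$ (k, l)))"
    unfolding choi_matrix_def tensor_map_def using assms LU
    by (auto simp: index_bound omega_entry kronecker_def matrix_unit_def carrier_matD[OF LU, unfolded matrix_unit_def] intro!: sum.cong)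
  also have "\<dots> = (\<Sum>a<d. \<Sum>b<d. (if i = a \<and> j = b then 1 else 0) * L (matrix_unit d a b) $$ (k, l))"
    by (intro sum.cong refl) (simp add: sum2_delta)
  also have "\<dots> = L (matrix_unit d i j) $$ (k, l)"
    using assms by (simp add: sum2_delta)
  finally show ?thesis .
qed

lemma ex_werner_map: "\<exists>W. is_werner_map d p W"
proof -
  define C where "C = werner_choi d p"
  define W where "W = (\<lambda>X. mat d d (\<lambda>(k, l). \<Sum>i<d. \<Sum>j<d. X $$ (i, j) * C $$ (i * d + k, j * d + l)))"
  have C: "C \<in> carrier_mat (d * d) (d * d)"
    by (auto simp: C_def werner_choi_def P_sym_def P_asym_def flip_matrix_def)
  have lin: "linear_map d d W"
    unfolding linear_map_def W_def
    by (auto intro!: eq_matI simp: algebra_simps sum.distrib sum_distrib_left)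
  have WU: "W (matrix_unit d i j) $$ (k, l) = C $$ (i * d + k, j * d + l)"
    if "i < d" "j < d" "k < d" "l < d" for i j k l
  proof -
    have "W (matrix_unit d i j) $$ (k, l) = (\<Sum>a<d. \<Sum>b<d. (if a = i \<and> b = j then 1 else 0) *
        C $$ (a * d + k, b * d + l))"
      unfolding W_def matrix_unit_def using that by (auto intro!: sum.cong)
    also have "\<dots> = C $$ (i * d + k, j * d + l)" using that by (simp add: sum2_delta)
    finally show ?thesis .
  qed
  have "choi_matrix d W = C"
  proof (rule eq_matI)
    fix r c assume "r < dim_row C" "c < dim_col C"
    then have rc: "r < d * d" "c < d * d" using C by auto
    note bd = index_split[OF rc(1)] index_split[OF rc(2)]
    have "choi_matrix d W $$ ((r div d) * d + r mod d, (c div d) * d + c mod d)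
      = C $$ ((r div d) * d + r mod d, (c div d) * d + c mod d)"
      using bd by (simp only: choi_matrix_entry[OF lin] WU)
    then show "choi_matrix d W $$ (r, c) = C $$ (r, c)" by simp
  qed (use C in \<open>auto simp: choi_matrix_def tensor_map_def\<close>)
  then show ?thesis using lin by (auto simp: is_werner_map_def C_def)
qed

lemma werner_map_unique:
  assumes W: "is_werner_map d p W" and W': "is_werner_map d p W'" and X: "X \<in> carrier_mat d d"
  shows "W X = W' X"
proof -
  have lin: "linear_map d d W" "linear_map d d W'"
    and choi: "choi_matrix d W = choi_matrix d W'"
    using W W' by (auto simp: is_werner_map_def)
  have "W X \<in> carrier_mat d d" "W' X \<in> carrier_mat d d"
    using lin X unfolding linear_map_def by auto
  moreover have "W X $$ (k, l) = W' X $$ (k, l)" if "k < d" "l < d" for k l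
    using that by (simp add: linear_map_entry[OF lin(1) X] linear_map_entry[OF lin(2) X]
        choi_matrix_entry[OF lin(1), symmetric] choi_matrix_entry[OF lin(2), symmetric] choi)
  ultimately show ?thesis by (intro eq_matI) auto
qed

end

theory Submission
  imports Defs
begin

text \<open>
  A map is decomposable iff its Choi operator is \<open>A + B\<^sup>\<Gamma>\<close> with \<open>A, B\<close> positive semidefinite,
  \<open>\<Gamma>\<close> the partial transposition. Here the Choi operator is a product of combinations of
  \<open>P_sym, P_asym\<close> on \<open>n\<close> sites and of their partial transposes on \<open>m\<close> sites. The latter are
  combinations of the commuting projections \<open>\<omega>/d\<close> and \<open>1 - \<omega>/d\<close>, and up to positive scalars the
  change of basis has on one site the coefficients \<open>1, 1, - 1, (d + 1) / (d - 1)\<close>. Its symmetrized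
  \<open>m\<close>-th power is the matrix \<open>V\<close>.

  If the program is nonnegative, Farkas' lemma gives \<open>\<alpha>, \<beta> \<ge> 0\<close> with
  \<open>v\<^sub>k v\<^sub>l = (\<Sum>j. V\<^sub>l\<^sub>j \<alpha>\<^sub>k\<^sub>j) + (\<Sum>i. V\<^sub>k\<^sub>i \<beta>\<^sub>i\<^sub>l)\<close>; then \<open>A\<close> and \<open>B\<close> are the sums of
  products of these projections weighted by \<open>\<alpha>\<close> and \<open>\<beta>\<close>. Conversely a feasible \<open>Q\<close> yields an
  operator \<open>X\<close> such that \<open>X\<close> and \<open>X\<^sup>\<Gamma>\<close> are nonnegative combinations of projections, and its trace
  against the Choi operator, which is the objective, equals \<open>tr (X A) + tr (X\<^sup>\<Gamma> B) \<ge> 0\<close>.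
\<close>

text \<open>Neither direction averages a given decomposition over the unitary group. Duality
  replaces the twirl: one direction builds a decomposition outright, the other only tests an
  arbitrary one against symmetric operators. Hence all operators built here are nonnegative
  combinations of real symmetric projections, and for these complete positivity and the sign of a
  trace follow from \<open>P = P P\<^sup>T\<close>, without spectral theory. The ratio
  \<open>(d + 1) / (d - 1)\<close> has two origins. It is \<open>d_sym d / d_asym d\<close>, the
  relative normalization of the two parts of a Werner operator, and it is an entry of the change of
  basis. The program contracts \<open>V\<close> over its row index, the dual weights over its column
  index. The same matrix can serve both because the one-site change of basis in the opposite
  direction has, up to positive diagonal scalings, the transposed coefficients. On several sites,
  passing between the two contractions costs binomial coefficients, the numbers of labels of given
  cardinalities.\<close>

declare sum.lessThan_Suc [simp del]

section \<open>Farkas' lemma\<close>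

text \<open>Induction by elimination of one constraint, so neither closedness of the cone nor a
  separation theorem enters. If the remaining constraints do not imply the conclusion, there is a
  direction \<open>y\<close> with \<open>ip (g a) y = 1\<close>; every functional is reduced by a
  multiple of \<open>g a\<close> until it vanishes at \<open>y\<close>, and the reduced system has
  one constraint fewer.\<close>

lemma farkas:
  fixes g :: "'s \<Rightarrow> 'i \<Rightarrow> real"
  assumes "finite S" "finite I"
    and "\<And>x. (\<forall>s\<in>S. 0 \<le> (\<Sum>i\<in>I. g s i * x i)) \<Longrightarrow> 0 \<le> (\<Sum>i\<in>I. c i * x i)"
  shows "\<exists>w. (\<forall>s\<in>S. 0 \<le> w s) \<and> (\<forall>i\<in>I. c i = (\<Sum>s\<in>S. w s * g s i))"
  using assms(1,3)
proof (induction S arbitrary: g c rule: finite_induct)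
  case empty
  have "0 \<le> (\<Sum>i\<in>I. c i * (- c i))" by (rule empty) simp
  then have "(\<Sum>i\<in>I. c i * c i) \<le> 0" by (simp add: sum_negf)
  moreover have "0 \<le> (\<Sum>i\<in>I. c i * c i)" by (simp add: sum_nonneg)
  ultimately have "\<forall>i\<in>I. c i * c i = 0"
    using sum_nonneg_eq_0_iff[OF \<open>finite I\<close>, of "\<lambda>i. c i * c i"] by simp
  then show ?case by simp
next
  case (insert a S)
  define ip where "ip f x = (\<Sum>i\<in>I. f i * x i)" for f x :: "'i \<Rightarrow> real"
  have ip_comb: "ip (\<lambda>i. f i - k * h i) x = ip f x - k * ip h x"
    "ip f (\<lambda>i. x i - k * y i) = ip f x - k * ip f y" for f h x y k
    by (simp_all add: ip_def algebra_simps sum_subtractf sum_distrib_left)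
  show ?case
  proof (cases "\<forall>x. (\<forall>s\<in>S. 0 \<le> ip (g s) x) \<longrightarrow> 0 \<le> ip c x")
    case True
    then obtain w where w: "\<forall>s\<in>S. 0 \<le> w s" "\<forall>i\<in>I. c i = (\<Sum>s\<in>S. w s * g s i)"
      using insert.IH[of g c] by (auto simp: ip_def)
    have "(\<Sum>s\<in>S. w s * g s i) = (\<Sum>s\<in>S. (w(a := 0)) s * g s i)" for i
      using insert.hyps by (intro sum.cong) auto
    then show ?thesis using w insert.hyps by (intro exI[of _ "w(a := 0)"]) auto
  next
    case False
    then obtain z where z: "\<forall>s\<in>S. 0 \<le> ip (g s) z" "ip c z < 0" by force
    have az: "ip (g a) z < 0"
      using insert.prems[of z] z by (force simp: ip_def)
    \<comment> \<open>Division by the negative number \<open>ip (g a) z\<close> reverses all signs: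
      \<open>c\<close> becomes positive at \<open>y\<close> and the constraints in \<open>S\<close>
      nonpositive, which makes \<open>k\<close> nonnegative below.\<close>
    define y where "y = (\<lambda>i. z i / ip (g a) z)"
    have ip_y: "ip f y = ip f z / ip (g a) z" for f
      by (simp add: ip_def y_def sum_divide_distrib)
    have y: "ip (g a) y = 1" "0 < ip c y" "\<forall>s\<in>S. ip (g s) y \<le> 0"
      using az z by (auto simp: ip_y divide_neg_neg divide_nonneg_neg)
    have "0 \<le> ip (\<lambda>i. c i - ip c y * g a i) x"
      if "\<forall>s\<in>S. 0 \<le> ip (\<lambda>i. g s i - ip (g s) y * g a i) x" for x
    proof -
      have eq: "ip f (\<lambda>i. x i - ip (g a) x * y i) = ip f x - ip (g a) x * ip f y" for f
        by (rule ip_comb(2))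
      have "\<forall>s\<in>insert a S. 0 \<le> ip (g s) (\<lambda>i. x i - ip (g a) x * y i)"
        using that y(1) unfolding eq ip_comb(1) by (auto simp: mult.commute)
      then have "0 \<le> ip c (\<lambda>i. x i - ip (g a) x * y i)"
        using insert.prems by (simp add: ip_def)
      then show ?thesis unfolding eq ip_comb(1) by (simp add: mult.commute)
    qed
    then obtain w where w: "\<forall>s\<in>S. 0 \<le> w s"
      "\<forall>i\<in>I. c i - ip c y * g a i = (\<Sum>s\<in>S. w s * (g s i - ip (g s) y * g a i))"
      using insert.IH[of "\<lambda>s i. g s i - ip (g s) y * g a i" "\<lambda>i. c i - ip c y * g a i"]
      by (auto simp: ip_def)
    \<comment> \<open>The coefficient that \<open>g a\<close> collects once the reductions of
      \<open>c\<close> and of all \<open>g s\<close> are undone.\<close>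
    define k where "k = ip c y - (\<Sum>s\<in>S. w s * ip (g s) y)"
    have "(\<Sum>s\<in>S. w s * ip (g s) y) \<le> 0"
      using w(1) y(3) by (intro sum_nonpos) (auto simp: mult_nonneg_nonpos)
    then have k: "0 \<le> k" using y(2) by (simp add: k_def)
    have "c i = k * g a i + (\<Sum>s\<in>S. w s * g s i)" if "i \<in> I" for i
      using w(2) that by (auto simp: k_def algebra_simps sum_subtractf sum_distrib_left sum_distrib_right)
    moreover have "(\<Sum>s\<in>S. w s * g s i) = (\<Sum>s\<in>S. (w(a := k)) s * g s i)" for i
      using insert.hyps by (intro sum.cong) auto
    ultimately show ?thesis using w(1) k insert.hyps by (intro exI[of _ "w(a := k)"]) auto
  qed
qed

section \<open>Binary labels and the matrix \<open>V\<close>\<close>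

text \<open>Choosing one summand per site amounts to choosing the set \<open>B\<close> of the sites
  with label \<open>True\<close>.\<close>

lemma prod_label_sum:
  fixes f :: "'a \<Rightarrow> bool \<Rightarrow> 'b :: comm_semiring_1"
  assumes "finite I"
  shows "(\<Prod>s\<in>I. \<Sum>a\<in>UNIV. f s a) = (\<Sum>B\<in>Pow I. \<Prod>s\<in>I. f s (s \<in> B))"
proof -
  have "(\<Prod>s\<in>I. \<Sum>a\<in>UNIV. f s a) = (\<Prod>s\<in>I. f s True + f s False)"
    by (simp add: UNIV_bool add.commute)
  also have "\<dots> = (\<Sum>B\<in>Pow I. (\<Prod>s\<in>B. f s True) * (\<Prod>s\<in>I - B. f s False))"
    using assms by (rule prod_add)
  also have "\<dots> = (\<Sum>B\<in>Pow I. \<Prod>s\<in>I. f s (s \<in> B))"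
  proof (rule sum.cong[OF refl])
    fix B assume "B \<in> Pow I"
    then have B: "B \<subseteq> I" by simp
    have "(\<Prod>s\<in>I. f s (s \<in> B)) = (\<Prod>s\<in>B. f s (s \<in> B)) * (\<Prod>s\<in>I - B. f s (s \<in> B))"
      by (simp only: prod.subset_diff[OF B assms] mult.commute)
    then show "(\<Prod>s\<in>B. f s True) * (\<Prod>s\<in>I - B. f s False) = (\<Prod>s\<in>I. f s (s \<in> B))"
      by simp
  qed
  finally show ?thesis .
qed

lemma sum_Pow_by_card:
  fixes f :: "'a set \<Rightarrow> 'b :: comm_monoid_add"
  assumes "finite I"
  shows "(\<Sum>B\<in>Pow I. f B) = (\<Sum>j<card I + 1. \<Sum>B | B \<subseteq> I \<and> card B = j. f B)"
proof -
  have "(\<Sum>B\<in>Pow I. f B) = (\<Sum>j\<in>{..<card I + 1}. \<Sum>B | B \<in> Pow I \<and> card B = j. f B)"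
    by (rule sum.group[symmetric]) (use assms in \<open>auto simp: card_mono less_Suc_eq_le\<close>)
  then show ?thesis by simp
qed

lemma sum_Pow_card:
  fixes g :: "nat \<Rightarrow> real"
  assumes "finite I"
  shows "(\<Sum>B\<in>Pow I. g (card B)) = (\<Sum>j<card I + 1. real (card I choose j) * g j)"
proof -
  have "(\<Sum>B | B \<subseteq> I \<and> card B = j. g (card B)) = real (card I choose j) * g j" for j
    by (simp add: n_subsets[OF assms])
  then show ?thesis by (simp only: sum_Pow_by_card[OF assms])
qed

lemma sum_Pow_card_weight:
  fixes f :: "nat \<Rightarrow> real"
  assumes "finite I"
  shows "(\<Sum>B\<in>Pow I. f (card B) / real (card I choose card B)) = (\<Sum>j<card I + 1. f j)"
  unfolding sum_Pow_card[OF assms, of "\<lambda>j. f j / real (card I choose j)"]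
  by (intro sum.cong) auto

lemma sum_Pow_Un:
  fixes f :: "'a set \<Rightarrow> 'b :: comm_monoid_add"
  assumes "I \<inter> J = {}"
  shows "(\<Sum>B\<in>Pow (I \<union> J). f B) = (\<Sum>C\<in>Pow I. \<Sum>D\<in>Pow J. f (C \<union> D))"
proof -
  have "(\<Sum>B\<in>Pow (I \<union> J). f B) = (\<Sum>(C, D)\<in>Pow I \<times> Pow J. f (C \<union> D))"
    by (rule sum.reindex_bij_witness[of _ "\<lambda>(C, D). C \<union> D" "\<lambda>B. (B \<inter> I, B \<inter> J)"])
      (use assms in \<open>auto intro!: arg_cong[of _ _ f]\<close>)
  then show ?thesis by (simp add: sum.cartesian_product)
qed

lemma prod_membership:
  fixes x y :: "'b :: comm_semiring_1"
  assumes "finite I" "C \<subseteq> I"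
  shows "(\<Prod>s\<in>I. if s \<in> C then x else y) = x ^ card C * y ^ (card I - card C)"
proof -
  have "(\<Prod>s\<in>I. if s \<in> C then x else y) = x ^ card (I \<inter> C) * y ^ card (I - C)"
    using assms(1) by (simp add: prod.If_cases Diff_eq Int_def Collect_neg_eq flip: Collect_mem_eq)
  also have "I \<inter> C = C" using assms by auto
  also have "card (I - C) = card I - card C"
    using assms by (intro card_Diff_subset) (auto intro: finite_subset)
  finally show ?thesis .
qed

text \<open>A set \<open>B\<close> is cut into a part \<open>C\<close> of size \<open>t\<close>
  inside \<open>A\<close> and a part \<open>D\<close> outside; the product depends on the two sizes
  only. The lower limit of \<open>t\<close> says that \<open>D\<close> must fit into
  \<open>I - A\<close>. These are the limits in \<open>V_mat\<close>.\<close>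

lemma sum_subsets_by_overlap:
  fixes f :: "bool \<Rightarrow> bool \<Rightarrow> real"
  assumes I: "finite I" and A: "A \<subseteq> I"
  shows "(\<Sum>B | B \<subseteq> I \<and> card B = b. \<Prod>s\<in>I. f (s \<in> A) (s \<in> B))
    = (\<Sum>t = card A + b - card I..min (card A) b.
        real (card A choose t) * real ((card I - card A) choose (b - t)) *
        (f True True ^ t * f True False ^ (card A - t) *
         (f False True ^ (b - t) * f False False ^ (card I - card A - (b - t)))))"
proof -
  define h where "h u v = (f True True ^ u * f True False ^ (card A - u) *
         (f False True ^ v * f False False ^ (card I - card A - v)))" for u v
  have fA: "finite A" and fD: "finite (I - A)" using I A by (auto intro: finite_subset)
  have cD: "card (I - A) = card I - card A" using A fA by (intro card_Diff_subset) auto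
  have cle: "card A \<le> card I" using A I by (rule card_mono[rotated])
  have pr: "(\<Prod>s\<in>I. f (s \<in> A) (s \<in> C \<union> D)) = h (card C) (card D)"
    if "C \<subseteq> A" "D \<subseteq> I - A" for C D
  proof -
    have "(\<Prod>s\<in>I. f (s \<in> A) (s \<in> C \<union> D))
      = (\<Prod>s\<in>A. f (s \<in> A) (s \<in> C \<union> D)) * (\<Prod>s\<in>I - A. f (s \<in> A) (s \<in> C \<union> D))"
      by (simp only: prod.subset_diff[OF A I] mult.commute)
    also have "(\<Prod>s\<in>A. f (s \<in> A) (s \<in> C \<union> D)) = (\<Prod>s\<in>A. if s \<in> C then f True True else f True False)"
    proof (rule prod.cong[OF refl])
      fix s assume s: "s \<in> A"
      then have "s \<notin> D" using that by auto
      then show "f (s \<in> A) (s \<in> C \<union> D) = (if s \<in> C then f True True else f True False)"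
        using s by simp
    qed
    also have "(\<Prod>s\<in>I - A. f (s \<in> A) (s \<in> C \<union> D))
      = (\<Prod>s\<in>I - A. if s \<in> D then f False True else f False False)"
    proof (rule prod.cong[OF refl])
      fix s assume s: "s \<in> I - A"
      then have "s \<notin> C" using that by auto
      then show "f (s \<in> A) (s \<in> C \<union> D) = (if s \<in> D then f False True else f False False)"
        using s by simp
    qed
    finally show ?thesis
      unfolding prod_membership[OF fA that(1)] prod_membership[OF fD that(2)] cD h_def .
  qed
  have "(\<Sum>B | B \<subseteq> I \<and> card B = b. \<Prod>s\<in>I. f (s \<in> A) (s \<in> B))
    = (\<Sum>B\<in>Pow I. if card B = b then \<Prod>s\<in>I. f (s \<in> A) (s \<in> B) else 0)"
    using sum.inter_filter[of "Pow I" "\<lambda>B. \<Prod>s\<in>I. f (s \<in> A) (s \<in> B)" "\<lambda>B. card B = b"] I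
    by (simp add: Pow_def)
  also have "\<dots> = (\<Sum>B\<in>Pow (A \<union> (I - A)). if card B = b then \<Prod>s\<in>I. f (s \<in> A) (s \<in> B) else 0)"
    using A by (simp add: Un_absorb1)
  also have "\<dots> = (\<Sum>C\<in>Pow A. \<Sum>D\<in>Pow (I - A).
      if card (C \<union> D) = b then \<Prod>s\<in>I. f (s \<in> A) (s \<in> C \<union> D) else 0)"
    by (rule sum_Pow_Un) auto
  also have "\<dots> = (\<Sum>C\<in>Pow A. \<Sum>D\<in>Pow (I - A). if card C + card D = b then h (card C) (card D) else 0)"
  proof (intro sum.cong refl)
    fix C D assume "C \<in> Pow A" "D \<in> Pow (I - A)"
    then have CD: "C \<subseteq> A" "D \<subseteq> I - A" "finite C" "finite D" "C \<inter> D = {}"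
      using fA fD by (auto intro: finite_subset)
    then show "(if card (C \<union> D) = b then \<Prod>s\<in>I. f (s \<in> A) (s \<in> C \<union> D) else 0)
      = (if card C + card D = b then h (card C) (card D) else 0)"
      by (simp only: pr card_Un_disjoint)
  qed
  also have "\<dots> = (\<Sum>t<card A + 1. real (card A choose t) *
      (\<Sum>v<card I - card A + 1. real (card I - card A choose v) * (if t + v = b then h t v else 0)))"
    unfolding sum_Pow_card[OF fD, unfolded cD, of "\<lambda>v. if card _ + v = b then h (card _) v else 0"]
    by (rule sum_Pow_card[OF fA])
  also have "\<dots> = (\<Sum>t<card A + 1. if card A + b - card I \<le> t \<and> t \<le> b then
      real (card A choose t) * real (card I - card A choose (b - t)) * h t (b - t) else 0)"
  proof (intro sum.cong refl)
    fix t assume "t \<in> {..<card A + 1}"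
    then have t: "t \<le> card A" by simp
    have "(\<Sum>v<card I - card A + 1. real (card I - card A choose v) * (if t + v = b then h t v else 0))
      = (\<Sum>v<card I - card A + 1. if v = b - t then
          (if t \<le> b then real (card I - card A choose v) * h t v else 0) else 0)"
      by (intro sum.cong) auto
    also have "\<dots> = (if card A + b - card I \<le> t \<and> t \<le> b then
        real (card I - card A choose (b - t)) * h t (b - t) else 0)"
      using t cle by (auto simp: sum.delta)
    finally show "real (card A choose t) *
      (\<Sum>v<card I - card A + 1. real (card I - card A choose v) * (if t + v = b then h t v else 0))
      = (if card A + b - card I \<le> t \<and> t \<le> b then
      real (card A choose t) * real (card I - card A choose (b - t)) * h t (b - t) else 0)"
      by simp
  qed
  also have "\<dots> = (\<Sum>t = card A + b - card I..min (card A) b.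
        real (card A choose t) * real (card I - card A choose (b - t)) * h t (b - t))"
    unfolding sum.inter_filter[OF finite_lessThan, symmetric] by (intro sum.cong) auto
  finally show ?thesis by (simp add: h_def)
qed

text \<open>For \<open>d \<ge> 2\<close> this is \<open>d_sym d / d_asym d\<close>: the factor left
  on \<open>P_asym\<close> when \<open>1 / d_sym d\<close> is pulled out of a Werner
  operator.\<close>

definition werner_ratio :: "nat \<Rightarrow> real" where
  "werner_ratio d = (real d + 1) / (real d - 1)"

text \<open>Rows \<open>a\<close> belong to the flip family, columns \<open>b\<close> to the family
  of \<open>omega\<close>; \<open>iso_op_eq\<close> is where the entries come from.\<close>

definition label_coeff :: "nat \<Rightarrow> bool \<Rightarrow> bool \<Rightarrow> real" where
  "label_coeff d a b = (if a then if b then werner_ratio d else - 1 else 1)"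

text \<open>Sites in both sets contribute the ratio, sites in \<open>A\<close> alone
  \<open>- 1\<close>, all others 1. With \<open>t\<close> sites of the first kind the sign is
  \<open>(- 1) ^ (card A - t)\<close>, which \<open>V_mat\<close> splits into a power outside the
  sum and one inside.\<close>

lemma V_mat_eq_sum_subsets:
  assumes I: "finite I" and A: "A \<subseteq> I" and b: "b < card I + 1"
  shows "V_mat d (card I) $$ (card A, b)
    = (\<Sum>B | B \<subseteq> I \<and> card B = b. \<Prod>s\<in>I. label_coeff d (s \<in> A) (s \<in> B))"
proof -
  have "(-1) ^ card A * (- werner_ratio d) ^ t = werner_ratio d ^ t * (- 1) ^ (card A - t)"
    if "t \<le> card A" for t
  proof -
    have "(-1 :: real) ^ card A * (-1) ^ t = (-1) ^ (card A - t)"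
      using that by (auto simp: minus_one_power_iff)
    then show ?thesis by (simp add: power_minus[of "werner_ratio d"] mult_ac)
  qed
  moreover have "card A < card I + 1" using A I by (simp add: card_mono less_Suc_eq_le)
  ultimately show ?thesis
    unfolding sum_subsets_by_overlap[OF I A]
    using b by (auto simp: V_mat_def label_coeff_def sum_distrib_left mult_ac
        werner_ratio_def[symmetric] intro!: sum.cong)
qed

text \<open>Double counting of the pairs of sets of sizes \<open>a\<close> and
  \<open>card B\<close>: whichever set is held fixed, the sum over the other depends on the sizes
  only.\<close>

lemma V_mat_eq_sum_subsets_row:
  assumes I: "finite I" and B: "B \<subseteq> I" and a: "a < card I + 1"
  shows "(\<Sum>A | A \<subseteq> I \<and> card A = a. \<Prod>s\<in>I. label_coeff d (s \<in> A) (s \<in> B))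
    / real (card I choose a) = V_mat d (card I) $$ (a, card B) / real (card I choose card B)"
proof -
  define R where "R B = (\<Sum>A | A \<subseteq> I \<and> card A = a. \<Prod>s\<in>I. label_coeff d (s \<in> A) (s \<in> B))" for B
  have R: "R B' = R B" if "B' \<subseteq> I" "card B' = card B" for B'
    unfolding R_def
    using sum_subsets_by_overlap[OF I that(1), where f = "\<lambda>x y. label_coeff d y x"]
      sum_subsets_by_overlap[OF I B, where f = "\<lambda>x y. label_coeff d y x"] that(2) by simp
  have b: "card B < card I + 1" using B I by (simp add: card_mono less_Suc_eq_le)
  have "real (card I choose card B) * R B = (\<Sum>B' | B' \<subseteq> I \<and> card B' = card B. R B')"
    using R by (simp add: n_subsets[OF I])
  also have "\<dots> = (\<Sum>A | A \<subseteq> I \<and> card A = a. \<Sum>B' | B' \<subseteq> I \<and> card B' = card B.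
      \<Prod>s\<in>I. label_coeff d (s \<in> A) (s \<in> B'))"
    unfolding R_def by (rule sum.swap)
  also have "\<dots> = (\<Sum>A | A \<subseteq> I \<and> card A = a. V_mat d (card I) $$ (a, card B))"
    by (intro sum.cong) (auto simp: V_mat_eq_sum_subsets[OF I _ b])
  also have "\<dots> = real (card I choose a) * V_mat d (card I) $$ (a, card B)"
    by (simp add: n_subsets[OF I])
  finally have "real (card I choose card B) * R B = real (card I choose a) * V_mat d (card I) $$ (a, card B)" .
  moreover have "card I choose a \<noteq> 0" "card I choose card B \<noteq> 0" using a b by simp_all
  ultimately show ?thesis by (simp add: R_def[symmetric] field_simps)
qed

text \<open>Weights that depend on the cardinality only still do so after the change of basis, and
  \<open>V\<close> acts on them from the left.\<close>

lemma sum_label_expand: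
  fixes t :: "'a \<Rightarrow> bool \<Rightarrow> real"
  assumes I: "finite I"
  shows "(\<Sum>B\<in>Pow I. f (card B) * (\<Prod>s\<in>I. \<Sum>a\<in>UNIV. label_coeff d a (s \<in> B) * t s a))
    = (\<Sum>A\<in>Pow I. (\<Sum>j<card I + 1. V_mat d (card I) $$ (card A, j) * f j) * (\<Prod>s\<in>I. t s (s \<in> A)))"
proof -
  have "(\<Sum>B\<in>Pow I. f (card B) * (\<Prod>s\<in>I. \<Sum>a\<in>UNIV. label_coeff d a (s \<in> B) * t s a))
    = (\<Sum>B\<in>Pow I. \<Sum>A\<in>Pow I. f (card B) * (\<Prod>s\<in>I. label_coeff d (s \<in> A) (s \<in> B)) * (\<Prod>s\<in>I. t s (s \<in> A)))"
    unfolding prod_label_sum[OF I] by (simp add: prod.distrib sum_distrib_left mult_ac)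
  also have "\<dots> = (\<Sum>A\<in>Pow I. (\<Sum>B\<in>Pow I. f (card B) * (\<Prod>s\<in>I. label_coeff d (s \<in> A) (s \<in> B)))
      * (\<Prod>s\<in>I. t s (s \<in> A)))"
    by (subst sum.swap) (simp add: sum_distrib_right)
  also have "\<dots> = (\<Sum>A\<in>Pow I. (\<Sum>j<card I + 1. V_mat d (card I) $$ (card A, j) * f j) * (\<Prod>s\<in>I. t s (s \<in> A)))"
  proof (intro sum.cong refl arg_cong2[where f = "(*)"])
    fix A assume "A \<in> Pow I"
    then have "A \<subseteq> I" by simp
    then show "(\<Sum>B\<in>Pow I. f (card B) * (\<Prod>s\<in>I. label_coeff d (s \<in> A) (s \<in> B)))
      = (\<Sum>j<card I + 1. V_mat d (card I) $$ (card A, j) * f j)"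
      by (subst sum_Pow_by_card[OF I])
        (auto simp: V_mat_eq_sum_subsets[OF I] sum_distrib_left mult.commute intro!: sum.cong)
  qed
  finally show ?thesis .
qed

text \<open>The change of basis in the other index: \<open>V\<close> acts from the right, as in the
  constraints of the program. Dividing each weight by the number of sets of its cardinality gives
  both sides the same form.\<close>

lemma sum_label_expand_row:
  fixes h :: "'a \<Rightarrow> bool \<Rightarrow> real"
  assumes I: "finite I"
  shows "(\<Sum>A\<in>Pow I. f (card A) / real (card I choose card A) *
      (\<Prod>s\<in>I. \<Sum>b\<in>UNIV. label_coeff d (s \<in> A) b * h s b))
    = (\<Sum>B\<in>Pow I. (\<Sum>l<card I + 1. f l * V_mat d (card I) $$ (l, card B)) /
        real (card I choose card B) * (\<Prod>s\<in>I. h s (s \<in> B)))"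
proof -
  let ?f = "\<lambda>A. f (card A) / real (card I choose card A)"
  have "(\<Sum>A\<in>Pow I. ?f A * (\<Prod>s\<in>I. \<Sum>b\<in>UNIV. label_coeff d (s \<in> A) b * h s b))
    = (\<Sum>A\<in>Pow I. \<Sum>B\<in>Pow I. ?f A * (\<Prod>s\<in>I. label_coeff d (s \<in> A) (s \<in> B)) * (\<Prod>s\<in>I. h s (s \<in> B)))"
    unfolding prod_label_sum[OF I] by (simp add: prod.distrib sum_distrib_left mult_ac)
  also have "\<dots> = (\<Sum>B\<in>Pow I. (\<Sum>A\<in>Pow I. ?f A * (\<Prod>s\<in>I. label_coeff d (s \<in> A) (s \<in> B)))
      * (\<Prod>s\<in>I. h s (s \<in> B)))"
    by (subst sum.swap) (simp add: sum_distrib_right)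
  also have "\<dots> = (\<Sum>B\<in>Pow I. (\<Sum>l<card I + 1. f l * V_mat d (card I) $$ (l, card B)) /
        real (card I choose card B) * (\<Prod>s\<in>I. h s (s \<in> B)))"
  proof (intro sum.cong refl arg_cong2[where f = "(*)"])
    fix B assume "B \<in> Pow I"
    then have B: "B \<subseteq> I" by simp
    have "(\<Sum>A | A \<subseteq> I \<and> card A = l. ?f A * (\<Prod>s\<in>I. label_coeff d (s \<in> A) (s \<in> B)))
      = f l * V_mat d (card I) $$ (l, card B) / real (card I choose card B)" if "l < card I + 1" for l
    proof -
      have "(\<Sum>A | A \<subseteq> I \<and> card A = l. ?f A * (\<Prod>s\<in>I. label_coeff d (s \<in> A) (s \<in> B)))
        = f l * ((\<Sum>A | A \<subseteq> I \<and> card A = l. \<Prod>s\<in>I. label_coeff d (s \<in> A) (s \<in> B)) / real (card I choose l))"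
        by (simp add: sum_distrib_left sum_divide_distrib)
      then show ?thesis unfolding V_mat_eq_sum_subsets_row[OF I B that] by simp
    qed
    then show "(\<Sum>A\<in>Pow I. ?f A * (\<Prod>s\<in>I. label_coeff d (s \<in> A) (s \<in> B)))
      = (\<Sum>l<card I + 1. f l * V_mat d (card I) $$ (l, card B)) / real (card I choose card B)"
      by (simp add: sum_Pow_by_card[OF I] sum_divide_distrib)
  qed
  finally show ?thesis .
qed

text \<open>With \<open>A\<close> the first \<open>a\<close> sites, distributivity turns the row
  into a product of linear forms. Two choices of \<open>x\<close> and \<open>y\<close> matter later:
  one produces \<open>v_vec\<close>, the other gives all rows the same value.\<close>

lemma V_mat_generating_function:
  assumes "a < m + 1"
  shows "(\<Sum>b<m + 1. V_mat d m $$ (a, b) * (x ^ b * y ^ (m - b)))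
    = (werner_ratio d * x - y) ^ a * (x + y) ^ (m - a)"
proof -
  let ?I = "{..<m}" and ?A = "{..<a}"
  let ?w = "\<lambda>b. if b then x else y"
  have A: "?A \<subseteq> ?I" "finite ?I" using assms by auto
  have "(\<Prod>s\<in>?I. \<Sum>b\<in>UNIV. label_coeff d (s \<in> ?A) b * ?w b)
    = (\<Sum>B\<in>Pow ?I. (\<Prod>s\<in>?I. label_coeff d (s \<in> ?A) (s \<in> B)) * (x ^ card B * y ^ (m - card B)))"
    unfolding prod_label_sum[OF A(2)] prod.distrib
    by (intro sum.cong refl arg_cong2[where f = "(*)"], subst prod_membership) auto
  also have "\<dots> = (\<Sum>b<m + 1. V_mat d m $$ (a, b) * (x ^ b * y ^ (m - b)))"
    unfolding sum_Pow_by_card[OF A(2)]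
    using V_mat_eq_sum_subsets[OF A(2,1)] by (intro sum.cong) (auto simp: sum_distrib_right)
  also have "(\<Prod>s\<in>?I. \<Sum>b\<in>UNIV. label_coeff d (s \<in> ?A) b * ?w b)
    = (\<Prod>s\<in>?I. if s \<in> ?A then werner_ratio d * x - y else x + y)"
    by (intro prod.cong) (auto simp: UNIV_bool label_coeff_def)
  also have "\<dots> = (werner_ratio d * x - y) ^ a * (x + y) ^ (m - a)"
    using prod_membership[OF A(2,1)] by simp
  finally show ?thesis by simp
qed

section \<open>Digits\<close>

text \<open>The least significant digit has number 0, so the right factor of
  \<open>kronecker\<close> occupies the low numbers.\<close>

definition digit :: "nat \<Rightarrow> nat \<Rightarrow> nat \<Rightarrow> nat" where
  "digit d s i = i div d ^ s mod d"

lemma digit_less: "0 < d \<Longrightarrow> digit d s i < d"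
  by (simp add: digit_def)

lemma digit_combine:
  assumes "k < d ^ m"
  shows "digit d s (i * d ^ m + k) = (if s < m then digit d s k else digit d (s - m) i)"
proof (cases "s < m")
  case True
  \<comment> \<open>The part \<open>i * d ^ m\<close> is divisible by \<open>d ^ (s + 1)\<close>;
    divided by \<open>d ^ s\<close> it is a multiple of \<open>d\<close> and vanishes modulo
    \<open>d\<close>.\<close>
  have "d ^ m = d ^ s * (d * d ^ (m - s - 1))"
    using True by (simp flip: power_add power_Suc)
  then have e: "i * d ^ m + k = k + d ^ s * (d * (d ^ (m - s - 1) * i))"
    by (simp only: mult_ac add.commute)
  have "d ^ s \<noteq> 0" using assms True by (cases "d = 0"; cases m) auto
  then have "(i * d ^ m + k) div d ^ s = d * (d ^ (m - s - 1) * i) + k div d ^ s"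
    unfolding e by (rule div_mult_self2)
  then have "digit d s (i * d ^ m + k) = digit d s k" by (simp add: digit_def)
  then show ?thesis using True by simp
next
  case False
  have "(i * d ^ m + k) div d ^ s = (i * d ^ m + k) div d ^ m div d ^ (s - m)"
    using False by (simp flip: div_mult2_eq power_add)
  also have "(i * d ^ m + k) div d ^ m = i + k div d ^ m"
    by (rule div_mult_self3[OF gr_implies_not0[OF assms]])
  also have "k div d ^ m = 0" using assms by (rule div_less)
  finally have "(i * d ^ m + k) div d ^ s = i div d ^ (s - m)" by simp
  then show ?thesis using False by (simp add: digit_def)
qed

lemma sum_index_combine:
  fixes f :: "nat \<Rightarrow> 'a :: comm_monoid_add"
  shows "(\<Sum>r<d1 * d2. f r) = (\<Sum>i<d1. \<Sum>k<d2. f (i * d2 + k))"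
proof -
  have "(\<Sum>r<d1 * d2. f r) = (\<Sum>i<d1. \<Sum>r\<in>{i * d2..<i * d2 + d2}. f r)"
    by (rule sum.nat_group[symmetric])
  also have "\<dots> = (\<Sum>i<d1. \<Sum>k<d2. f (i * d2 + k))"
  proof (rule sum.cong[OF refl])
    fix i
    show "(\<Sum>r\<in>{i * d2..<i * d2 + d2}. f r) = (\<Sum>k<d2. f (i * d2 + k))"
      using sum.shift_bounds_nat_ivl[of f 0 "i * d2" d2] by (simp add: atLeast0LessThan add.commute)
  qed
  finally show ?thesis .
qed

text \<open>The indices below \<open>d ^ N\<close> run through all digit strings of length
  \<open>N\<close>, so this is distributivity.\<close>

lemma sum_prod_digits:
  fixes g :: "nat \<Rightarrow> nat \<Rightarrow> 'a :: comm_semiring_1"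
  shows "(\<Sum>i<d ^ N. \<Prod>s<N. g s (digit d s i)) = (\<Prod>s<N. \<Sum>i<d. g s i)"
proof (induction N)
  case 0
  then show ?case by simp
next
  case (Suc N)
  have "(\<Sum>i<d ^ Suc N. \<Prod>s<Suc N. g s (digit d s i))
    = (\<Sum>i<d. \<Sum>k<d ^ N. \<Prod>s<Suc N. g s (digit d s (i * d ^ N + k)))"
    by (simp only: power_Suc sum_index_combine)
  also have "\<dots> = (\<Sum>i<d. \<Sum>k<d ^ N. (\<Prod>s<N. g s (digit d s k)) * g N i)"
    by (intro sum.cong refl) (simp add: digit_combine, simp add: digit_def)
  also have "\<dots> = (\<Prod>s<Suc N. \<Sum>i<d. g s i)"
    by (simp add: Suc.IH sum_distrib_left flip: sum_distrib_right)
  finally show ?case .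
qed

section \<open>Operators on a bipartite space and their tensor products\<close>

text \<open>Rows and columns are indexed by pairs: input index first, output index second, as in the Choi matrix.\<close>

type_synonym 'a biop = "nat \<times> nat \<Rightarrow> nat \<times> nat \<Rightarrow> 'a"

definition square :: "nat \<Rightarrow> (nat \<times> nat) set" where
  "square d = {..<d} \<times> {..<d}"

lemma finite_square [simp]: "finite (square d)"
  by (simp add: square_def)

text \<open>The second components are output indices, so this is what transposing the output of a
  map does to its Choi operator.\<close>

definition partial_transpose :: "'a biop \<Rightarrow> 'a biop" where
  "partial_transpose F x y = F (fst x, snd y) (fst y, snd x)"

definition trace_pairing :: "nat \<Rightarrow> 'a biop \<Rightarrow> 'a biop \<Rightarrow> 'a :: comm_semiring_1" where
  "trace_pairing d F G = (\<Sum>x\<in>square d. \<Sum>y\<in>square d. F x y * G y x)"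

definition is_projection :: "nat \<Rightarrow> real biop \<Rightarrow> bool" where
  "is_projection d F \<longleftrightarrow> (\<forall>x\<in>square d. \<forall>y\<in>square d.
     F y x = F x y \<and> (\<Sum>q\<in>square d. F x q * F q y) = F x y)"

definition digit_pair :: "nat \<Rightarrow> nat \<Rightarrow> nat \<times> nat \<Rightarrow> nat \<times> nat" where
  "digit_pair d s x = (digit d s (fst x), digit d s (snd x))"

definition tensor_op :: "nat \<Rightarrow> nat set \<Rightarrow> (nat \<Rightarrow> 'a biop) \<Rightarrow> 'a :: comm_monoid_mult biop" where
  "tensor_op d I F x y = (\<Prod>s\<in>I. F s (digit_pair d s x) (digit_pair d s y))"

lemma digit_pair_square: "0 < d \<Longrightarrow> digit_pair d s x \<in> square d"
  by (simp add: digit_pair_def square_def digit_less)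

lemma sum_prod_digit_pairs:
  fixes g :: "nat \<Rightarrow> nat \<times> nat \<Rightarrow> 'a :: comm_semiring_1"
  shows "(\<Sum>x\<in>square (d ^ N). \<Prod>s<N. g s (digit_pair d s x)) = (\<Prod>s<N. \<Sum>x\<in>square d. g s x)"
proof -
  have "(\<Sum>x\<in>square (d ^ N). \<Prod>s<N. g s (digit_pair d s x))
    = (\<Sum>i<d ^ N. \<Sum>k<d ^ N. \<Prod>s<N. g s (digit d s i, digit d s k))"
    by (simp add: square_def digit_pair_def sum.cartesian_product case_prod_unfold)
  also have "\<dots> = (\<Sum>i<d ^ N. \<Prod>s<N. \<Sum>k<d. g s (digit d s i, k))"
    by (intro sum.cong refl sum_prod_digits)
  also have "\<dots> = (\<Prod>s<N. \<Sum>i<d. \<Sum>k<d. g s (i, k))"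
    by (rule sum_prod_digits)
  finally show ?thesis by (simp add: square_def sum.cartesian_product)
qed

lemma trace_pairing_tensor_op:
  fixes F G :: "nat \<Rightarrow> 'a :: comm_semiring_1 biop"
  shows "trace_pairing (d ^ N) (tensor_op d {..<N} F) (tensor_op d {..<N} G)
    = (\<Prod>s<N. trace_pairing d (F s) (G s))"
proof -
  have "trace_pairing (d ^ N) (tensor_op d {..<N} F) (tensor_op d {..<N} G)
    = (\<Sum>x\<in>square (d ^ N). \<Prod>s<N. \<Sum>y\<in>square d. F s (digit_pair d s x) y * G s y (digit_pair d s x))"
    unfolding trace_pairing_def tensor_op_def prod.distrib[symmetric]
    by (intro sum.cong refl) (rule sum_prod_digit_pairs)
  also have "\<dots> = (\<Prod>s<N. trace_pairing d (F s) (G s))"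
    unfolding trace_pairing_def by (rule sum_prod_digit_pairs)
  finally show ?thesis .
qed

lemma is_projection_tensor_op:
  assumes "0 < d" and "\<And>s. s < N \<Longrightarrow> is_projection d (F s)"
  shows "is_projection (d ^ N) (tensor_op d {..<N} F)"
  unfolding is_projection_def
proof (intro ballI conjI)
  fix x y
  note sq = digit_pair_square[OF assms(1)]
  show "tensor_op d {..<N} F y x = tensor_op d {..<N} F x y"
    unfolding tensor_op_def using assms(2) sq
    by (intro prod.cong refl) (meson is_projection_def lessThan_iff)
  have "(\<Sum>q\<in>square (d ^ N). tensor_op d {..<N} F x q * tensor_op d {..<N} F q y)
    = (\<Prod>s<N. \<Sum>q\<in>square d. F s (digit_pair d s x) q * F s q (digit_pair d s y))"
    unfolding tensor_op_def prod.distrib[symmetric] by (rule sum_prod_digit_pairs)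
  also have "\<dots> = tensor_op d {..<N} F x y"
    unfolding tensor_op_def
  proof (rule prod.cong[OF refl])
    fix s assume "s \<in> {..<N}"
    then have "is_projection d (F s)" using assms(2) by simp
    then show "(\<Sum>q\<in>square d. F s (digit_pair d s x) q * F s q (digit_pair d s y))
      = F s (digit_pair d s x) (digit_pair d s y)"
      unfolding is_projection_def using sq[of s x] sq[of s y] by blast
  qed
  finally show "(\<Sum>q\<in>square (d ^ N). tensor_op d {..<N} F x q * tensor_op d {..<N} F q y)
    = tensor_op d {..<N} F x y" .
qed

lemma partial_transpose_tensor_op:
  "partial_transpose (tensor_op d I F) = tensor_op d I (\<lambda>s. partial_transpose (F s))"
  by (intro ext) (simp add: partial_transpose_def tensor_op_def digit_pair_def)

lemma partial_transpose_partial_transpose [simp]: "partial_transpose (partial_transpose F) = F"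
  by (intro ext) (simp add: partial_transpose_def)

text \<open>Both traces are sums over four indices; exchanging the names of the two output indices
  carries one into the other.\<close>

lemma trace_pairing_partial_transpose:
  "trace_pairing d (partial_transpose F) G = trace_pairing d F (partial_transpose G)"
proof -
  have sw: "(\<Sum>k<d. \<Sum>j<d. \<Sum>l<d. h k j l) = (\<Sum>l<d. \<Sum>j<d. \<Sum>k<d. h k j l)" for h :: "nat \<Rightarrow> nat \<Rightarrow> nat \<Rightarrow> 'a"
    by (subst sum.swap, subst (2) sum.swap, subst (1) sum.swap) (rule refl)
  have "(\<Sum>i<d. \<Sum>k<d. \<Sum>j<d. \<Sum>l<d. F (i, l) (j, k) * G (j, l) (i, k))
    = (\<Sum>i<d. \<Sum>l<d. \<Sum>j<d. \<Sum>k<d. F (i, l) (j, k) * G (j, l) (i, k))"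
    by (intro sum.cong refl sw)
  then show ?thesis
    by (simp add: trace_pairing_def partial_transpose_def square_def sum.cartesian_product')
qed

section \<open>The two-parameter families spanned by the identity and the flip\<close>

definition flip_op :: "real \<Rightarrow> real \<Rightarrow> real biop" where
  "flip_op a b x y = (if x = y then a else 0) + (if x = prod.swap y then b else 0)"

definition omega_op :: "real \<Rightarrow> real \<Rightarrow> real biop" where
  "omega_op a b x y = (if x = y then a else 0) + (if fst x = snd x \<and> fst y = snd y then b else 0)"

text \<open>Exchanging \<open>snd x\<close> with \<open>snd y\<close> turns the condition
  \<open>x = prod.swap y\<close> of the flip into that of \<open>omega\<close> and preserves
  \<open>x = y\<close>.\<close>

lemma partial_transpose_flip_op [simp]: "partial_transpose (flip_op a b) = omega_op a b"
  by (intro ext) (auto simp: partial_transpose_def flip_op_def omega_op_def prod_eq_iff)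

lemma partial_transpose_omega_op [simp]: "partial_transpose (omega_op a b) = flip_op a b"
  using partial_transpose_partial_transpose[of "flip_op a b"] by simp

lemma flip_op_sym: "flip_op a b y x = flip_op a b x y"
  by (auto simp: flip_op_def)

lemma omega_op_sym: "omega_op a b y x = omega_op a b x y"
  by (auto simp: omega_op_def)

text \<open>The flip squares to the identity, so coefficients multiply as in the group algebra of
  the group of order two.\<close>

lemma flip_op_comp:
  assumes "x \<in> square d" "y \<in> square d"
  shows "(\<Sum>q\<in>square d. flip_op a b x q * flip_op a' b' q y) = flip_op (a * a' + b * b') (a * b' + b * a') x y"
proof -
  have "(\<Sum>q\<in>square d. flip_op a b x q * flip_op a' b' q y)
    = (\<Sum>q\<in>square d. if x = q then a * flip_op a' b' x y else 0)
     + (\<Sum>q\<in>square d. if prod.swap x = q then b * flip_op a' b' (prod.swap x) y else 0)"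
    unfolding sum.distrib[symmetric]
  proof (rule sum.cong[OF refl])
    fix q
    have "flip_op a b x q = (if x = q then a else 0) + (if prod.swap x = q then b else 0)"
      by (cases x; cases q) (simp add: flip_op_def)
    then show "flip_op a b x q * flip_op a' b' q y
      = (if x = q then a * flip_op a' b' x y else 0)
        + (if prod.swap x = q then b * flip_op a' b' (prod.swap x) y else 0)"
      by (auto simp: distrib_right)
  qed
  also have "\<dots> = a * flip_op a' b' x y + b * flip_op a' b' (prod.swap x) y"
    using assms(1) by (auto simp: square_def mem_Times_iff)
  also have "\<dots> = flip_op (a * a' + b * b') (a * b' + b * a') x y"
  proof -
    have "prod.swap x = y \<longleftrightarrow> x = prod.swap y" "prod.swap x = prod.swap y \<longleftrightarrow> x = y"
      by (auto simp: prod_eq_iff)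
    then show ?thesis unfolding flip_op_def
      by (simp add: distrib_left distrib_right)
  qed
  finally show ?thesis .
qed

lemma sum_square_diag: "(\<Sum>q\<in>square d. if fst q = snd q then f q else 0) = (\<Sum>i<d. f (i, i))"
  by (simp add: square_def sum.delta sum.cartesian_product')

text \<open>\<open>omega\<close> has rank one and squares to \<open>d\<close> times itself, hence
  the factor \<open>d\<close>.\<close>

lemma omega_op_comp:
  assumes "x \<in> square d" "y \<in> square d"
  shows "(\<Sum>q\<in>square d. omega_op a b x q * omega_op a' b' q y)
    = omega_op (a * a') (a * b' + b * a' + real d * b * b') x y"
proof -
  \<comment> \<open>The unnormalized maximally entangled vector; \<open>omega\<close> is its outer
    product with itself.\<close>
  define w :: "nat \<times> nat \<Rightarrow> real" where "w q = (if fst q = snd q then 1 else 0)" for q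
  have O: "omega_op a b x y = (if x = y then a else 0) + b * (w x * w y)" for a b x y
    by (simp add: omega_op_def w_def)
  have "(\<Sum>q\<in>square d. w q * w q) = (\<Sum>q\<in>square d. if fst q = snd q then 1 else 0)"
    by (intro sum.cong) (auto simp: w_def)
  then have ww: "(\<Sum>q\<in>square d. w q * w q) = real d"
    by (simp add: sum_square_diag)
  have "(\<Sum>q\<in>square d. w q * omega_op a' b' q y)
    = (\<Sum>q\<in>square d. if q = y then w y * a' else 0) + b' * w y * (\<Sum>q\<in>square d. w q * w q)"
    unfolding sum_distrib_left sum.distrib[symmetric]
    by (intro sum.cong refl) (simp add: O distrib_left)
  then have right: "(\<Sum>q\<in>square d. w q * omega_op a' b' q y) = w y * a' + b' * w y * real d"
    using assms by (simp add: ww)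
  have "(\<Sum>q\<in>square d. omega_op a b x q * omega_op a' b' q y)
    = (\<Sum>q\<in>square d. if x = q then a * omega_op a' b' x y else 0)
      + b * w x * (\<Sum>q\<in>square d. w q * omega_op a' b' q y)"
    unfolding sum_distrib_left sum.distrib[symmetric]
    by (intro sum.cong refl) (simp add: O[of a b] distrib_right)
  also have "\<dots> = a * omega_op a' b' x y + b * w x * (w y * a' + b' * w y * real d)"
    using assms unfolding right by simp
  also have "\<dots> = omega_op (a * a') (a * b' + b * a' + real d * b * b') x y"
    by (simp add: O algebra_simps)
  finally show ?thesis .
qed

lemma trace_flip_op: "(\<Sum>x\<in>square d. flip_op a b x x) = real d * real d * a + real d * b"
proof -
  have "(\<Sum>x\<in>square d. flip_op a b x x) = (\<Sum>x\<in>square d. a) + (\<Sum>x\<in>square d. if fst x = snd x then b else 0)"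
    unfolding sum.distrib[symmetric]
    by (intro sum.cong refl) (auto simp: flip_op_def prod_eq_iff)
  then show ?thesis by (simp add: sum_square_diag, simp add: square_def)
qed

lemma trace_pairing_flip_op:
  "trace_pairing d (flip_op a b) (flip_op a' b')
    = real d * real d * (a * a' + b * b') + real d * (a * b' + b * a')"
proof -
  have "trace_pairing d (flip_op a b) (flip_op a' b')
    = (\<Sum>x\<in>square d. flip_op (a * a' + b * b') (a * b' + b * a') x x)"
    unfolding trace_pairing_def by (intro sum.cong refl flip_op_comp)
  then show ?thesis by (simp add: trace_flip_op)
qed

section \<open>Complete positivity and Choi operators\<close>

text \<open>Two dimensions, because complete positivity involves amplifications of any size
  \<open>k\<close>.\<close>

definition psd_op :: "nat \<Rightarrow> nat \<Rightarrow> complex biop \<Rightarrow> bool" where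
  "psd_op a b A \<longleftrightarrow> (\<forall>v. 0 \<le> (\<Sum>i<a. \<Sum>k<b. \<Sum>j<a. \<Sum>l<b. cnj (v (i, k)) * A (i, k) (j, l) * v (j, l)))"

definition choi_op :: "nat \<Rightarrow> (complex mat \<Rightarrow> complex mat) \<Rightarrow> complex biop" where
  "choi_op d L x y = L (matrix_unit d (fst x) (fst y)) $$ (snd x, snd y)"

lemma matrix_unit_carrier [simp]: "matrix_unit d i j \<in> carrier_mat d d"
  by (simp add: matrix_unit_def)

lemma quadratic_form_eq:
  assumes "M \<in> carrier_mat n n" "x \<in> carrier_vec n"
  shows "(M *\<^sub>v x) \<bullet>c x = (\<Sum>r<n. \<Sum>c<n. cnj (x $ r) * M $$ (r, c) * x $ c)"
proof -
  have "(M *\<^sub>v x) \<bullet>c x = (\<Sum>r<n. (M *\<^sub>v x) $ r * cnj (x $ r))"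
    using assms(2) by (simp add: scalar_prod_def atLeast0LessThan)
  also have "\<dots> = (\<Sum>r<n. \<Sum>c<n. cnj (x $ r) * M $$ (r, c) * x $ c)"
  proof (rule sum.cong[OF refl])
    fix r assume "r \<in> {..<n}"
    then have "(M *\<^sub>v x) $ r = (\<Sum>c<n. M $$ (r, c) * x $ c)"
      using assms by (simp add: scalar_prod_def atLeast0LessThan)
    then show "(M *\<^sub>v x) $ r * cnj (x $ r) = (\<Sum>c<n. cnj (x $ r) * M $$ (r, c) * x $ c)"
      by (simp add: sum_distrib_left mult_ac)
  qed
  finally show ?thesis .
qed

lemma positive_semidefinite_iff_psd_op:
  assumes M: "M \<in> carrier_mat (a * b) (a * b)"
  shows "positive_semidefinite (a * b) M
    \<longleftrightarrow> psd_op a b (\<lambda>x y. M $$ (fst x * b + snd x, fst y * b + snd y))"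
proof -
  have q: "(M *\<^sub>v x) \<bullet>c x = (\<Sum>i<a. \<Sum>k<b. \<Sum>j<a. \<Sum>l<b.
      cnj (x $ (i * b + k)) * M $$ (i * b + k, j * b + l) * x $ (j * b + l))"
    if "x \<in> carrier_vec (a * b)" for x
    unfolding quadratic_form_eq[OF M that] sum_index_combine ..
  show ?thesis
  proof
    assume P: "positive_semidefinite (a * b) M"
    show "psd_op a b (\<lambda>x y. M $$ (fst x * b + snd x, fst y * b + snd y))"
      unfolding psd_op_def
    proof
      fix v :: "nat \<times> nat \<Rightarrow> complex"
      define x where "x = vec (a * b) (\<lambda>r. v (r div b, r mod b))"
      have x: "x \<in> carrier_vec (a * b)" by (simp add: x_def)
      have "x $ (i * b + k) = v (i, k)" if "i < a" "k < b" for i k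
        using that by (simp add: x_def index_bound)
      then have "(M *\<^sub>v x) \<bullet>c x = (\<Sum>i<a. \<Sum>k<b. \<Sum>j<a. \<Sum>l<b.
          cnj (v (i, k)) * M $$ (i * b + k, j * b + l) * v (j, l))"
        unfolding q[OF x] by (intro sum.cong refl) auto
      moreover have "0 \<le> (M *\<^sub>v x) \<bullet>c x"
        using P x unfolding positive_semidefinite_def by blast
      ultimately show "0 \<le> (\<Sum>i<a. \<Sum>k<b. \<Sum>j<a. \<Sum>l<b. cnj (v (i, k)) *
          M $$ (fst (i, k) * b + snd (i, k), fst (j, l) * b + snd (j, l)) * v (j, l))"
        by simp
    qed
  next
    assume P: "psd_op a b (\<lambda>x y. M $$ (fst x * b + snd x, fst y * b + snd y))"
    show "positive_semidefinite (a * b) M"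
      unfolding positive_semidefinite_def
    proof (intro conjI ballI M)
      fix x :: "complex vec" assume x: "x \<in> carrier_vec (a * b)"
      show "0 \<le> (M *\<^sub>v x) \<bullet>c x"
        using P[unfolded psd_op_def, rule_format, of "\<lambda>(i, k). x $ (i * b + k)"]
        unfolding q[OF x] by simp
    qed
  qed
qed

section \<open>Choi operators of tensor products\<close>

lemma tensor_map_entry:
  assumes "\<And>i j. L1 (matrix_unit d1 i j) \<in> carrier_mat e1 e1"
    and "\<And>k l. L2 (matrix_unit d2 k l) \<in> carrier_mat e2 e2"
    and "r < e1" "c < e1" "s < e2" "t < e2"
  shows "tensor_map d1 e1 L1 d2 e2 L2 X $$ (r * e2 + s, c * e2 + t)
    = (\<Sum>i<d1. \<Sum>j<d1. \<Sum>k<d2. \<Sum>l<d2. X $$ (i * d2 + k, j * d2 + l) *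
        (L1 (matrix_unit d1 i j) $$ (r, c) * L2 (matrix_unit d2 k l) $$ (s, t)))"
proof -
  have "kronecker (L1 (matrix_unit d1 i j)) (L2 (matrix_unit d2 k l)) $$ (r * e2 + s, c * e2 + t)
    = L1 (matrix_unit d1 i j) $$ (r, c) * L2 (matrix_unit d2 k l) $$ (s, t)" for i j k l
    using assms(3-) carrier_matD[OF assms(1)] carrier_matD[OF assms(2)]
    by (simp add: kronecker_def index_bound)
  then show ?thesis using assms(3-) by (simp add: tensor_map_def index_bound)
qed

lemma linear_map_tensor_map: "linear_map (d1 * d2) (e1 * e2) (tensor_map d1 e1 L1 d2 e2 L2)"
  unfolding linear_map_def tensor_map_def
  by (auto intro!: eq_matI sum.cong simp: index_bound distrib_right sum.distrib sum_distrib_left mult.assoc)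

lemma linear_map_tensor_power: "linear_map (d ^ n) (d ^ n) (tensor_power d L n)"
proof (cases n)
  case 0
  then show ?thesis by (simp add: linear_map_def)
next
  case (Suc k)
  then show ?thesis using linear_map_tensor_map[of d "d ^ k" d "d ^ k"] by simp
qed

text \<open>Merging inputs with inputs and outputs with outputs is the reshuffling under which the
  Choi operator is multiplicative.\<close>

lemma choi_op_tensor_map:
  assumes L1: "linear_map d1 d1 L1" and L2: "linear_map d2 d2 L2"
    and "i < d1" "j < d1" "r < d1" "c < d1" "k < d2" "l < d2" "s < d2" "t < d2"
  shows "choi_op (d1 * d2) (tensor_map d1 d1 L1 d2 d2 L2)
      (i * d2 + k, r * d2 + s) (j * d2 + l, c * d2 + t)
    = choi_op d1 L1 (i, r) (j, c) * choi_op d2 L2 (k, s) (l, t)"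
proof -
  let ?L = "\<lambda>a b e f. L1 (matrix_unit d1 a b) $$ (r, c) * L2 (matrix_unit d2 e f) $$ (s, t)"
  have eq: "i * d2 + k = a * d2 + e \<longleftrightarrow> i = a \<and> k = e" if "e < d2" "k < d2" for i k a e
    using that by (metis div_mult_self3 add.right_neutral div_less mod_mult_self3 mod_less
        gr_implies_not0)
  have "tensor_map d1 d1 L1 d2 d2 L2 (matrix_unit (d1 * d2) (i * d2 + k) (j * d2 + l))
      $$ (r * d2 + s, c * d2 + t)
    = (\<Sum>a<d1. \<Sum>b<d1. \<Sum>e<d2. \<Sum>f<d2.
        matrix_unit (d1 * d2) (i * d2 + k) (j * d2 + l) $$ (a * d2 + e, b * d2 + f) * ?L a b e f)"
    by (rule tensor_map_entry) (use assms in \<open>auto simp: linear_map_def\<close>)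
  also have "\<dots> = (\<Sum>a<d1. \<Sum>b<d1. (if a = i \<and> b = j then 1 else 0) *
      (\<Sum>e<d2. \<Sum>f<d2. (if e = k \<and> f = l then 1 else 0) * ?L a b e f))"
    unfolding sum_distrib_left using assms(3-)
    by (intro sum.cong refl) (auto simp: matrix_unit_def index_bound eq)
  also have "\<dots> = ?L i j k l" using assms(3-) by (simp only: sum2_delta)
  finally show ?thesis by (simp add: choi_op_def)
qed

lemma choi_op_tensor_power:
  assumes L: "linear_map d d L" and "x \<in> square (d ^ n)" "y \<in> square (d ^ n)"
  shows "choi_op (d ^ n) (tensor_power d L n) x y = tensor_op d {..<n} (\<lambda>s. choi_op d L) x y"
  using assms(2,3)
proof (induction n arbitrary: x y)
  case 0
  then show ?case by (simp add: choi_op_def tensor_op_def square_def matrix_unit_def mem_Times_iff)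
next
  case (Suc n)
  define D where "D = d ^ n"
  have split: "i = (i div D) * D + i mod D \<and> i div D < d \<and> i mod D < D" if "i < d ^ Suc n" for i
    using index_split[of i d D] that by (simp add: D_def div_mult_mod_eq)
  obtain i r j c where xy: "x = (i, r)" "y = (j, c)" by (cases x; cases y)
  then have b: "i < d ^ Suc n" "r < d ^ Suc n" "j < d ^ Suc n" "c < d ^ Suc n"
    using Suc.prems by (auto simp: square_def)
  note sp = split[OF b(1)] split[OF b(2)] split[OF b(3)] split[OF b(4)]
  have dig: "digit d s i = (if s < n then digit d s (i mod D) else i div D)"
    if "i < d ^ Suc n" "s < Suc n" for i s
  proof -
    have "digit d s i = digit d s ((i div D) * d ^ n + i mod D)" unfolding D_def by (simp only: div_mult_mod_eq)
    also have "\<dots> = (if s < n then digit d s (i mod D) else digit d (s - n) (i div D))"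
      using split[OF that(1)] by (intro digit_combine) (simp add: D_def)
    finally show ?thesis
      using that split[OF that(1)] by (auto simp: digit_def)
  qed
  have "choi_op (d ^ Suc n) (tensor_power d L (Suc n)) x y
    = choi_op (d * D) (tensor_map d d L D D (tensor_power d L n))
        ((i div D) * D + i mod D, (r div D) * D + r mod D) ((j div D) * D + j mod D, (c div D) * D + c mod D)"
    by (simp add: xy D_def div_mult_mod_eq)
  also have "\<dots> = choi_op d L (i div D, r div D) (j div D, c div D) *
      choi_op D (tensor_power d L n) (i mod D, r mod D) (j mod D, c mod D)"
    by (rule choi_op_tensor_map[OF L]) (use sp linear_map_tensor_power in \<open>auto simp: D_def\<close>)
  also have "choi_op D (tensor_power d L n) (i mod D, r mod D) (j mod D, c mod D)
    = tensor_op d {..<n} (\<lambda>s. choi_op d L) (i mod D, r mod D) (j mod D, c mod D)"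
    unfolding D_def by (rule Suc.IH) (use sp in \<open>auto simp: square_def D_def\<close>)
  also have "choi_op d L (i div D, r div D) (j div D, c div D) * \<dots>
    = tensor_op d {..<Suc n} (\<lambda>s. choi_op d L) x y"
    using b by (simp add: tensor_op_def digit_pair_def xy dig mult.commute)
  finally show ?case .
qed

text \<open>The right factor has the low digits, hence the sites of \<open>L2\<close> are those
  below \<open>m\<close> and the sites of \<open>L1\<close> follow.\<close>

lemma choi_op_tensor_powers:
  assumes L1: "linear_map d d L1" and L2: "linear_map d d L2"
    and x: "x \<in> square (d ^ (n + m))" and y: "y \<in> square (d ^ (n + m))"
  shows "choi_op (d ^ (n + m))
      (tensor_map (d ^ n) (d ^ n) (tensor_power d L1 n) (d ^ m) (d ^ m) (tensor_power d L2 m)) x y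
    = tensor_op d {..<n + m} (\<lambda>s. if s < m then choi_op d L2 else choi_op d L1) x y"
proof -
  define D where "D = d ^ m"
  have split: "i = (i div D) * D + i mod D \<and> i div D < d ^ n \<and> i mod D < D" if "i < d ^ (n + m)" for i
    using index_split[of i "d ^ n" D] that by (simp add: D_def power_add div_mult_mod_eq)
  obtain i r j c where xy: "x = (i, r)" "y = (j, c)" by (cases x; cases y)
  then have b: "i < d ^ (n + m)" "r < d ^ (n + m)" "j < d ^ (n + m)" "c < d ^ (n + m)"
    using x y by (auto simp: square_def)
  note sp = split[OF b(1)] split[OF b(2)] split[OF b(3)] split[OF b(4)]
  have dig: "digit d s i = (if s < m then digit d s (i mod D) else digit d (s - m) (i div D))"
    if "i < d ^ (n + m)" for i s
  proof -
    have "digit d s i = digit d s ((i div D) * d ^ m + i mod D)" unfolding D_def by (simp only: div_mult_mod_eq)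
    also have "\<dots> = (if s < m then digit d s (i mod D) else digit d (s - m) (i div D))"
      using split[OF that(1)] by (intro digit_combine) (simp add: D_def)
    finally show ?thesis .
  qed
  let ?P1 = "tensor_power d L1 n" and ?P2 = "tensor_power d L2 m"
  have "choi_op (d ^ (n + m)) (tensor_map (d ^ n) (d ^ n) ?P1 D D ?P2) x y
    = choi_op (d ^ n * D) (tensor_map (d ^ n) (d ^ n) ?P1 D D ?P2)
        ((i div D) * D + i mod D, (r div D) * D + r mod D) ((j div D) * D + j mod D, (c div D) * D + c mod D)"
    by (simp add: xy D_def power_add div_mult_mod_eq)
  also have "\<dots> = choi_op (d ^ n) ?P1 (i div D, r div D) (j div D, c div D) *
      choi_op D ?P2 (i mod D, r mod D) (j mod D, c mod D)"
    by (rule choi_op_tensor_map) (use sp linear_map_tensor_power in \<open>auto simp: D_def\<close>)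
  also have "choi_op D ?P2 (i mod D, r mod D) (j mod D, c mod D)
    = tensor_op d {..<m} (\<lambda>s. choi_op d L2) (i mod D, r mod D) (j mod D, c mod D)"
    unfolding D_def by (rule choi_op_tensor_power[OF L2]) (use sp in \<open>auto simp: square_def D_def\<close>)
  also have "choi_op (d ^ n) ?P1 (i div D, r div D) (j div D, c div D)
    = tensor_op d {..<n} (\<lambda>s. choi_op d L1) (i div D, r div D) (j div D, c div D)"
    by (rule choi_op_tensor_power[OF L1]) (use sp in \<open>auto simp: square_def D_def\<close>)
  also have "tensor_op d {..<n} (\<lambda>s. choi_op d L1) (i div D, r div D) (j div D, c div D)
      * tensor_op d {..<m} (\<lambda>s. choi_op d L2) (i mod D, r mod D) (j mod D, c mod D)
    = tensor_op d {..<n + m} (\<lambda>s. if s < m then choi_op d L2 else choi_op d L1) x y"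
  proof -
    let ?t = "\<lambda>s. (if s < m then choi_op d L2 else choi_op d L1) (digit_pair d s x) (digit_pair d s y)"
    have "tensor_op d {..<n + m} (\<lambda>s. if s < m then choi_op d L2 else choi_op d L1) x y
      = (\<Prod>s<m. ?t s) * (\<Prod>s\<in>{m..<m + n}. ?t s)"
      unfolding tensor_op_def
      by (subst prod.union_disjoint[symmetric]) (auto intro!: prod.cong)
    also have "(\<Prod>s\<in>{m..<m + n}. ?t s) = (\<Prod>s<n. ?t (s + m))"
      using prod.shift_bounds_nat_ivl[of ?t 0 m n] by (simp add: atLeast0LessThan add.commute)
    also have "\<dots> = tensor_op d {..<n} (\<lambda>s. choi_op d L1) (i div D, r div D) (j div D, c div D)"
      using b by (simp add: tensor_op_def digit_pair_def xy dig)
    also have "(\<Prod>s<m. ?t s) = tensor_op d {..<m} (\<lambda>s. choi_op d L2) (i mod D, r mod D) (j mod D, c mod D)"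
      using b by (simp add: tensor_op_def digit_pair_def xy dig)
    finally show ?thesis by (simp add: mult.commute)
  qed
  finally show ?thesis by (simp add: D_def)
qed

section \<open>Complete positivity and positivity of Choi operators\<close>

lemma psd_op_omega: "psd_op d d (\<lambda>x y. omega d $$ (fst x * d + snd x, fst y * d + snd y))"
  unfolding psd_op_def
proof
  fix v :: "nat \<times> nat \<Rightarrow> complex"
  \<comment> \<open>The overlap of \<open>v\<close> with the unnormalized maximally entangled
    vector; the quadratic form is its squared modulus.\<close>
  define w where "w = (\<Sum>j<d. v (j, j))"
  have "(\<Sum>i<d. \<Sum>k<d. \<Sum>j<d. \<Sum>l<d. cnj (v (i, k)) *
      omega d $$ (fst (i, k) * d + snd (i, k), fst (j, l) * d + snd (j, l)) * v (j, l))
    = (\<Sum>i<d. \<Sum>k<d. \<Sum>j<d. \<Sum>l<d. if k = i then if l = j then cnj (v (i, i)) * v (j, j) else 0 else 0)"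
    by (intro sum.cong refl) (auto simp: omega_entry)
  also have "\<dots> = (\<Sum>i<d. \<Sum>k<d. if k = i then \<Sum>j<d. \<Sum>l<d. if l = j then cnj (v (i, i)) * v (j, j) else 0 else 0)"
    by (intro sum.cong refl) auto
  also have "\<dots> = cnj w * w"
    by (simp add: w_def sum.delta sum_product)
  also have "0 \<le> cnj w * w" by (simp add: mult.commute[of "cnj w"] complex_norm_square[symmetric] less_eq_complex_def)
  finally show "0 \<le> (\<Sum>i<d. \<Sum>k<d. \<Sum>j<d. \<Sum>l<d. cnj (v (i, k)) *
      omega d $$ (fst (i, k) * d + snd (i, k), fst (j, l) * d + snd (j, l)) * v (j, l))" .
qed

text \<open>The amplification of size \<open>d\<close> takes the positive matrix
  \<open>omega d\<close> to the Choi matrix.\<close>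

lemma completely_positive_psd_choi_op:
  assumes "completely_positive d d T"
  shows "psd_op d d (choi_op d T)"
proof -
  have lin: "linear_map d d T" using assms by (simp add: completely_positive_def)
  have "positive_semidefinite (d * d) (omega d)"
    using psd_op_omega[of d] by (subst positive_semidefinite_iff_psd_op) (auto simp: omega_def)
  then have "positive_semidefinite (d * d) (choi_matrix d T)"
    using assms by (simp add: completely_positive_def choi_matrix_def)
  then have "psd_op d d (\<lambda>x y. choi_matrix d T $$ (fst x * d + snd x, fst y * d + snd y))"
    by (subst (asm) positive_semidefinite_iff_psd_op) (auto simp: choi_matrix_def tensor_map_def)
  then show ?thesis
    by (simp add: psd_op_def choi_matrix_entry[OF lin] choi_op_def cong: sum.cong_simp)
qed

text \<open>Inverts the passage from a map to its Choi operator, for real operators.\<close>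

definition choi_map :: "nat \<Rightarrow> real biop \<Rightarrow> complex mat \<Rightarrow> complex mat" where
  "choi_map d A X = mat d d (\<lambda>(k, l). \<Sum>i<d. \<Sum>j<d. X $$ (i, j) * complex_of_real (A (i, k) (j, l)))"

lemma linear_map_choi_map: "linear_map d d (choi_map d A)"
  unfolding linear_map_def choi_map_def
  by (auto intro!: eq_matI simp: distrib_right sum.distrib sum_distrib_left mult.assoc)

lemma choi_map_unit:
  assumes "p < d" "q < d" "k < d" "l < d"
  shows "choi_map d A (matrix_unit d p q) $$ (k, l) = complex_of_real (A (p, k) (q, l))"
proof -
  have "choi_map d A (matrix_unit d p q) $$ (k, l)
    = (\<Sum>i<d. \<Sum>j<d. (if i = p \<and> j = q then 1 else 0) * complex_of_real (A (i, k) (j, l)))"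
    using assms by (auto simp: choi_map_def matrix_unit_def intro!: sum.cong)
  then show ?thesis using assms by (simp only: sum2_delta)
qed

text \<open>Each \<open>g t\<close> is a Kraus operator in disguise: with \<open>K\<close> the
  matrix of the entries \<open>g t (p, k)\<close>, its share of the map is
  \<open>X \<mapsto> K\<^sup>T X K\<close>, which preserves positivity under every
  amplification.\<close>

lemma completely_positive_choi_map:
  fixes g :: "'t \<Rightarrow> nat \<times> nat \<Rightarrow> real"
  assumes "finite T"
    and A: "\<And>x y. x \<in> square d \<Longrightarrow> y \<in> square d \<Longrightarrow> A x y = (\<Sum>t\<in>T. g t x * g t y)"
  shows "completely_positive d d (choi_map d A)"
  unfolding completely_positive_def
proof (intro conjI allI impI linear_map_choi_map)
  fix n X assume "positive_semidefinite (n * d) X"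
  moreover from this have X: "X \<in> carrier_mat (n * d) (n * d)"
    by (simp add: positive_semidefinite_def)
  ultimately have psd: "psd_op n d (\<lambda>x y. X $$ (fst x * d + snd x, fst y * d + snd y))"
    by (simp add: positive_semidefinite_iff_psd_op)
  let ?Y = "tensor_map n n id d d (choi_map d A) X"
  have Y: "?Y $$ (a * d + k, b * d + l)
    = (\<Sum>p<d. \<Sum>q<d. X $$ (a * d + p, b * d + q) * (\<Sum>t\<in>T. complex_of_real (g t (p, k) * g t (q, l))))"
    if "a < n" "b < n" "k < d" "l < d" for a b k l
  proof -
    have "?Y $$ (a * d + k, b * d + l) = (\<Sum>i<n. \<Sum>j<n. \<Sum>p<d. \<Sum>q<d. X $$ (i * d + p, j * d + q) *
        (id (matrix_unit n i j) $$ (a, b) * choi_map d A (matrix_unit d p q) $$ (k, l)))"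
      by (rule tensor_map_entry) (use that linear_map_choi_map in \<open>auto simp: linear_map_def\<close>)
    also have "\<dots> = (\<Sum>i<n. \<Sum>j<n. (if a = i \<and> b = j then 1 else 0) * (\<Sum>p<d. \<Sum>q<d.
        X $$ (i * d + p, j * d + q) * complex_of_real (A (p, k) (q, l))))"
      unfolding sum_distrib_left
    proof (intro sum.cong refl)
      fix i j p q assume "i \<in> {..<n}" "j \<in> {..<n}" "p \<in> {..<d}" "q \<in> {..<d}"
      then have "matrix_unit n i j $$ (a, b) = (if a = i \<and> b = j then 1 else 0)"
        "choi_map d A (matrix_unit d p q) $$ (k, l) = complex_of_real (A (p, k) (q, l))"
        using that by (simp add: matrix_unit_def, intro choi_map_unit) auto
      then show "X $$ (i * d + p, j * d + q) *
          (id (matrix_unit n i j) $$ (a, b) * choi_map d A (matrix_unit d p q) $$ (k, l))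
        = (if a = i \<and> b = j then 1 else 0) *
          (X $$ (i * d + p, j * d + q) * complex_of_real (A (p, k) (q, l)))"
        by simp
    qed
    also have "\<dots> = (\<Sum>p<d. \<Sum>q<d. X $$ (a * d + p, b * d + q) * complex_of_real (A (p, k) (q, l)))"
      using that by (simp only: sum2_delta)
    also have "\<dots> = (\<Sum>p<d. \<Sum>q<d. X $$ (a * d + p, b * d + q) *
        (\<Sum>t\<in>T. complex_of_real (g t (p, k) * g t (q, l))))"
      using that by (intro sum.cong refl) (simp add: A square_def)
    finally show ?thesis .
  qed
  have "psd_op n d (\<lambda>x y. ?Y $$ (fst x * d + snd x, fst y * d + snd y))"
    unfolding psd_op_def
  proof
    fix v :: "nat \<times> nat \<Rightarrow> complex"
    \<comment> \<open>\<open>z t\<close> is \<open>v\<close> with the matrix \<open>K\<close> of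
      \<open>t\<close> applied to its second component; the form of the image at \<open>v\<close> is
      the sum over \<open>t\<close> of the forms of \<open>X\<close> at \<open>z t\<close>.\<close>
    define z where "z t x = (\<Sum>l<d. complex_of_real (g t (snd x, l)) * v (fst x, l))" for t x
    let ?N = "{..<n}" and ?D = "{..<d}"
    have "(\<Sum>a<n. \<Sum>k<d. \<Sum>b<n. \<Sum>l<d. cnj (v (a, k)) *
        ?Y $$ (fst (a, k) * d + snd (a, k), fst (b, l) * d + snd (b, l)) * v (b, l))
      = (\<Sum>a<n. \<Sum>k<d. \<Sum>b<n. \<Sum>l<d. \<Sum>p<d. \<Sum>q<d. \<Sum>t\<in>T. cnj (v (a, k)) *
          (X $$ (a * d + p, b * d + q) * complex_of_real (g t (p, k) * g t (q, l))) * v (b, l))"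
      by (intro sum.cong refl) (simp add: Y sum_distrib_left sum_distrib_right)
    also have "\<dots> = (\<Sum>(a, k, b, l, p, q, t)\<in>?N \<times> ?D \<times> ?N \<times> ?D \<times> ?D \<times> ?D \<times> T. cnj (v (a, k)) *
          (X $$ (a * d + p, b * d + q) * complex_of_real (g t (p, k) * g t (q, l))) * v (b, l))"
      by (simp add: sum.cartesian_product')
    \<comment> \<open>One bijection of sevenfold products replaces a chain of exchanges of
      sums.\<close>
    also have "\<dots> = (\<Sum>(t, a, p, b, q, k, l)\<in>T \<times> ?N \<times> ?D \<times> ?N \<times> ?D \<times> ?D \<times> ?D. cnj (v (a, k)) *
          (X $$ (a * d + p, b * d + q) * complex_of_real (g t (p, k) * g t (q, l))) * v (b, l))"
      by (rule sum.reindex_bij_witness[of _ "\<lambda>(t, a, p, b, q, k, l). (a, k, b, l, p, q, t)"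
          "\<lambda>(a, k, b, l, p, q, t). (t, a, p, b, q, k, l)"]) auto
    also have "\<dots> = (\<Sum>t\<in>T. \<Sum>a<n. \<Sum>p<d. \<Sum>b<n. \<Sum>q<d. \<Sum>k<d. \<Sum>l<d. cnj (v (a, k)) *
          (X $$ (a * d + p, b * d + q) * complex_of_real (g t (p, k) * g t (q, l))) * v (b, l))"
      by (simp add: sum.cartesian_product')
    also have "\<dots> = (\<Sum>t\<in>T. \<Sum>a<n. \<Sum>p<d. \<Sum>b<n. \<Sum>q<d.
        cnj (z t (a, p)) * X $$ (a * d + p, b * d + q) * z t (b, q))"
      by (intro sum.cong refl) (simp add: z_def sum_distrib_left sum_distrib_right mult_ac)
    also have "0 \<le> \<dots>"
    proof (rule sum_nonneg)
      fix t
      show "0 \<le> (\<Sum>a<n. \<Sum>p<d. \<Sum>b<n. \<Sum>q<d.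
          cnj (z t (a, p)) * X $$ (a * d + p, b * d + q) * z t (b, q))"
        using psd[unfolded psd_op_def, rule_format, of "z t"] by simp
    qed
    finally show "0 \<le> (\<Sum>a<n. \<Sum>k<d. \<Sum>b<n. \<Sum>l<d. cnj (v (a, k)) *
        ?Y $$ (fst (a, k) * d + snd (a, k), fst (b, l) * d + snd (b, l)) * v (b, l))" .
  qed
  then show "positive_semidefinite (n * d) ?Y"
    by (subst positive_semidefinite_iff_psd_op) (auto simp: tensor_map_def)
qed

section \<open>The cone generated by projections\<close>

text \<open>The index set has the type of the labels used later, since the existential quantifier
  cannot range over types.\<close>

definition projection_cone :: "nat \<Rightarrow> real biop \<Rightarrow> bool" where
  "projection_cone d A \<longleftrightarrow> (\<exists>S :: (nat set \<times> nat set) set. \<exists>c P. finite S \<and> (\<forall>s\<in>S. 0 \<le> c s \<and> is_projection d (P s)) \<and>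
     (\<forall>x\<in>square d. \<forall>y\<in>square d. A x y = (\<Sum>s\<in>S. c s * P s x y)))"

lemma is_projection_gram:
  assumes P: "is_projection d P" and x: "x \<in> square d" and y: "y \<in> square d"
  shows "P x y = (\<Sum>q\<in>square d. P x q * P y q)"
proof -
  have "(\<Sum>q\<in>square d. P x q * P q y) = P x y"
    using P x y unfolding is_projection_def by blast
  then have "P x y = (\<Sum>q\<in>square d. P x q * P q y)" ..
  also have "\<dots> = (\<Sum>q\<in>square d. P x q * P y q)"
  proof (rule sum.cong[OF refl])
    fix q assume "q \<in> square d"
    then have "P q y = P y q" using P y unfolding is_projection_def by blast
    then show "P x q * P q y = P x q * P y q" by (rule arg_cong)
  qed
  finally show ?thesis .
qed

lemma completely_positive_projection_cone:
  assumes "projection_cone d A"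
  shows "completely_positive d d (choi_map d A)"
proof -
  obtain S :: "(nat set \<times> nat set) set" and c P where S: "finite S"
    and c: "\<And>s. s \<in> S \<Longrightarrow> 0 \<le> c s" and P: "\<And>s. s \<in> S \<Longrightarrow> is_projection d (P s)"
    and A: "\<And>x y. x \<in> square d \<Longrightarrow> y \<in> square d \<Longrightarrow> A x y = (\<Sum>s\<in>S. c s * P s x y)"
    using assms unfolding projection_cone_def by blast
  \<comment> \<open>The columns of the projections, scaled by square roots of the coefficients, are
    the vectors of a Gram decomposition.\<close>
  define g where "g t x = sqrt (c (fst t)) * P (fst t) x (snd t)" for t x
  have "A x y = (\<Sum>t\<in>S \<times> square d. g t x * g t y)" if x: "x \<in> square d" and y: "y \<in> square d" for x y
  proof -
    have "c s * P s x y = (\<Sum>q\<in>square d. g (s, q) x * g (s, q) y)" if s: "s \<in> S" for s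
    proof -
      note is_projection_gram[OF P[OF s] x y]
      moreover have "g (s, q) x * g (s, q) y = c s * (P s x q * P s y q)" for q
      proof -
        have "g (s, q) x * g (s, q) y = (sqrt (c s) * sqrt (c s)) * (P s x q * P s y q)"
          by (simp only: g_def fst_conv snd_conv mult_ac)
        then show ?thesis using c[OF s] by simp
      qed
      ultimately show ?thesis by (simp add: sum_distrib_left)
    qed
    then show ?thesis by (simp add: A x y sum.cartesian_product')
  qed
  then show ?thesis using S by (intro completely_positive_choi_map[of "S \<times> square d"]) auto
qed

text \<open>The trace is the sum of the quadratic forms of \<open>A\<close> at the columns of
  \<open>P\<close>.\<close>

lemma trace_projection_psd_nonneg:
  assumes P: "is_projection d P" and A: "psd_op d d A"
  shows "0 \<le> trace_pairing d (\<lambda>x y. complex_of_real (P x y)) A"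
proof -
  have "trace_pairing d (\<lambda>x y. complex_of_real (P x y)) A
    = (\<Sum>x\<in>square d. \<Sum>y\<in>square d. \<Sum>q\<in>square d. complex_of_real (P y q) * A y x * complex_of_real (P x q))"
    unfolding trace_pairing_def
  proof (intro sum.cong refl)
    fix x y assume x: "x \<in> square d" and y: "y \<in> square d"
    note is_projection_gram[OF P x y]
    then have "complex_of_real (P x y) = (\<Sum>q\<in>square d. complex_of_real (P x q) * complex_of_real (P y q))"
      by simp
    then show "complex_of_real (P x y) * A y x
      = (\<Sum>q\<in>square d. complex_of_real (P y q) * A y x * complex_of_real (P x q))"
      by (simp add: sum_distrib_left mult_ac)
  qed
  also have "\<dots> = (\<Sum>q\<in>square d. \<Sum>y\<in>square d. \<Sum>x\<in>square d.
      cnj (complex_of_real (P y q)) * A y x * complex_of_real (P x q))"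
    by (subst sum.swap[of _ "square d" "square d"], subst (2) sum.swap, subst (1) sum.swap) simp
  also have "0 \<le> \<dots>"
  proof (rule sum_nonneg)
    fix q
    show "0 \<le> (\<Sum>y\<in>square d. \<Sum>x\<in>square d. cnj (complex_of_real (P y q)) * A y x * complex_of_real (P x q))"
      using A[unfolded psd_op_def, rule_format, of "\<lambda>x. complex_of_real (P x q)"]
      by (simp add: square_def sum.cartesian_product')
  qed
  finally show ?thesis .
qed

text \<open>A form without index set that is stable under tensor products, where the scalars
  multiply. The operators \<open>iso_op\<close> are only multiples of projections.\<close>

definition scaled_projection :: "nat \<Rightarrow> real biop \<Rightarrow> bool" where
  "scaled_projection d F \<longleftrightarrow> (\<exists>c P. 0 \<le> c \<and> is_projection d P \<and>
     (\<forall>x\<in>square d. \<forall>y\<in>square d. F x y = c * P x y))"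

lemma scaled_projection_scale:
  assumes "scaled_projection d F" "0 \<le> k"
  shows "scaled_projection d (\<lambda>x y. k * F x y)"
proof -
  obtain c P where "0 \<le> c" "is_projection d P" "\<forall>x\<in>square d. \<forall>y\<in>square d. F x y = c * P x y"
    using assms(1) unfolding scaled_projection_def by blast
  then show ?thesis using assms(2) unfolding scaled_projection_def
    by (intro exI[of _ "k * c"] exI[of _ P]) auto
qed

lemma scaled_projection_tensor_op:
  assumes d: "0 < d" and F: "\<And>s. s < N \<Longrightarrow> scaled_projection d (F s)"
  shows "scaled_projection (d ^ N) (tensor_op d {..<N} F)"
proof -
  have "\<forall>s. \<exists>c P. s < N \<longrightarrow> 0 \<le> c \<and> is_projection d P \<and>
     (\<forall>x\<in>square d. \<forall>y\<in>square d. F s x y = c * P x y)"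
    using F unfolding scaled_projection_def by blast
  then obtain c P where cP: "\<And>s. s < N \<Longrightarrow> 0 \<le> c s \<and> is_projection d (P s) \<and>
     (\<forall>x\<in>square d. \<forall>y\<in>square d. F s x y = c s * P s x y)"
    by metis
  have "tensor_op d {..<N} F x y = (\<Prod>s<N. c s) * tensor_op d {..<N} P x y" for x y
    unfolding tensor_op_def prod.distrib[symmetric]
    using cP digit_pair_square[OF d] by (intro prod.cong refl) auto
  moreover have "is_projection (d ^ N) (tensor_op d {..<N} P)"
    using d cP by (intro is_projection_tensor_op) auto
  moreover have "0 \<le> (\<Prod>s<N. c s)" using cP by (intro prod_nonneg) auto
  ultimately show ?thesis unfolding scaled_projection_def by blast
qed

lemma projection_cone_sum:
  fixes S :: "(nat set \<times> nat set) set"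
  assumes "finite S" and F: "\<And>s. s \<in> S \<Longrightarrow> scaled_projection d (F s)"
    and A: "\<And>x y. x \<in> square d \<Longrightarrow> y \<in> square d \<Longrightarrow> A x y = (\<Sum>s\<in>S. F s x y)"
  shows "projection_cone d A"
proof -
  have "\<forall>s. \<exists>c P. s \<in> S \<longrightarrow> 0 \<le> c \<and> is_projection d P \<and>
     (\<forall>x\<in>square d. \<forall>y\<in>square d. F s x y = c * P x y)"
    using F unfolding scaled_projection_def by blast
  then obtain c P where cP: "\<And>s. s \<in> S \<Longrightarrow> 0 \<le> c s \<and> is_projection d (P s) \<and>
     (\<forall>x\<in>square d. \<forall>y\<in>square d. F s x y = c s * P s x y)"
    by metis
  show ?thesis unfolding projection_cone_def
    by (rule exI[of _ S], rule exI[of _ c], rule exI[of _ P]) (use assms(1) cP A in auto)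
qed

lemma trace_pairing_sum_left:
  "trace_pairing d (\<lambda>x y. \<Sum>s\<in>S. c s * F s x y) G = (\<Sum>s\<in>S. c s * trace_pairing d (F s) G)"
proof -
  have "trace_pairing d (\<lambda>x y. \<Sum>s\<in>S. c s * F s x y) G
    = (\<Sum>x\<in>square d. \<Sum>s\<in>S. \<Sum>y\<in>square d. c s * (F s x y * G y x))"
    unfolding trace_pairing_def
    by (intro sum.cong refl, subst sum.swap) (simp add: sum_distrib_right mult.assoc)
  also have "\<dots> = (\<Sum>s\<in>S. c s * trace_pairing d (F s) G)"
    unfolding trace_pairing_def by (subst sum.swap) (simp add: sum_distrib_left)
  finally show ?thesis .
qed

lemma trace_pairing_add_right:
  "trace_pairing d F (\<lambda>x y. G x y + H x y) = trace_pairing d F G + trace_pairing d F H"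
  by (simp add: trace_pairing_def distrib_left sum.distrib)

lemma trace_pairing_cong:
  assumes "\<And>x y. x \<in> square d \<Longrightarrow> y \<in> square d \<Longrightarrow> F x y = F' x y"
    and "\<And>x y. x \<in> square d \<Longrightarrow> y \<in> square d \<Longrightarrow> G x y = G' x y"
  shows "trace_pairing d F G = trace_pairing d F' G'"
  unfolding trace_pairing_def using assms by (intro sum.cong refl) simp

lemma trace_pairing_of_real:
  "trace_pairing d (\<lambda>x y. complex_of_real (F x y)) (\<lambda>x y. complex_of_real (G x y))
    = complex_of_real (trace_pairing d F G)"
  by (simp add: trace_pairing_def)

lemma trace_projection_cone_psd_nonneg:
  assumes X: "projection_cone d X" and A: "psd_op d d A"
  shows "0 \<le> trace_pairing d (\<lambda>x y. complex_of_real (X x y)) A"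
proof -
  obtain S :: "(nat set \<times> nat set) set" and c P where S: "finite S"
    and c: "\<And>s. s \<in> S \<Longrightarrow> 0 \<le> c s" and P: "\<And>s. s \<in> S \<Longrightarrow> is_projection d (P s)"
    and X: "\<And>x y. x \<in> square d \<Longrightarrow> y \<in> square d \<Longrightarrow> X x y = (\<Sum>s\<in>S. c s * P s x y)"
    using X unfolding projection_cone_def by blast
  have "trace_pairing d (\<lambda>x y. complex_of_real (X x y)) A
    = trace_pairing d (\<lambda>x y. \<Sum>s\<in>S. complex_of_real (c s) * complex_of_real (P s x y)) A"
    by (rule trace_pairing_cong) (simp_all add: X)
  also have "\<dots> = (\<Sum>s\<in>S. complex_of_real (c s) * trace_pairing d (\<lambda>x y. complex_of_real (P s x y)) A)"
    by (rule trace_pairing_sum_left)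
  also have "0 \<le> \<dots>"
    using c P A by (intro sum_nonneg mult_nonneg_nonneg trace_projection_psd_nonneg)
      (auto simp: less_eq_complex_def)
  finally show ?thesis .
qed

section \<open>Decomposability in terms of Choi operators\<close>

lemma decomposable_choi_op:
  assumes "decomposable d d L"
  shows "\<exists>A B. psd_op d d A \<and> psd_op d d B \<and>
    (\<forall>x\<in>square d. \<forall>y\<in>square d. choi_op d L x y = A x y + partial_transpose B x y)"
proof -
  obtain T1 T2 where T: "completely_positive d d T1" "completely_positive d d T2"
    and L: "\<forall>X \<in> carrier_mat d d. L X = T1 X + transpose_mat (T2 X)"
    using assms by (auto simp: decomposable_def)
  have c: "T1 (matrix_unit d i j) \<in> carrier_mat d d" "T2 (matrix_unit d i j) \<in> carrier_mat d d" for i j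
    using T by (auto simp: completely_positive_def linear_map_def)
  have "choi_op d L x y = choi_op d T1 x y + partial_transpose (choi_op d T2) x y"
    if "x \<in> square d" "y \<in> square d" for x y
    using that carrier_matD[OF c(1)] carrier_matD[OF c(2)]
    by (auto simp: choi_op_def partial_transpose_def L square_def)
  then show ?thesis using T[THEN completely_positive_psd_choi_op] by blast
qed

text \<open>A converse restricted to the cone of projections, where complete positivity comes from
  explicit Gram vectors.\<close>

lemma decomposable_if_choi_op:
  assumes L: "linear_map d d L" and A: "projection_cone d A" and B: "projection_cone d B"
    and choi: "\<And>x y. x \<in> square d \<Longrightarrow> y \<in> square d \<Longrightarrow>
      choi_op d L x y = complex_of_real (A x y + partial_transpose B x y)"
  shows "decomposable d d L"
  unfolding decomposable_def
proof (intro conjI exI ballI L)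
  show "completely_positive d d (choi_map d A)" "completely_positive d d (choi_map d B)"
    using A B by (simp_all add: completely_positive_projection_cone)
  fix X :: "complex mat" assume X: "X \<in> carrier_mat d d"
  then have LX: "L X \<in> carrier_mat d d" using L by (simp add: linear_map_def)
  show "L X = choi_map d A X + transpose_mat (choi_map d B X)"
  proof (rule eq_matI)
    fix k l assume "k < dim_row (choi_map d A X + transpose_mat (choi_map d B X))"
      "l < dim_col (choi_map d A X + transpose_mat (choi_map d B X))"
    then have kl: "k < d" "l < d" by (auto simp: choi_map_def)
    have "L X $$ (k, l) = (\<Sum>i<d. \<Sum>j<d. X $$ (i, j) * choi_op d L (i, k) (j, l))"
      using linear_map_entry[OF L X kl] by (simp add: choi_op_def)
    also have "\<dots> = (\<Sum>i<d. \<Sum>j<d. X $$ (i, j) * complex_of_real (A (i, k) (j, l) + B (i, l) (j, k)))"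
      using kl by (intro sum.cong refl) (simp add: choi square_def partial_transpose_def)
    also have "\<dots> = (choi_map d A X + transpose_mat (choi_map d B X)) $$ (k, l)"
      using kl by (simp add: choi_map_def distrib_left sum.distrib)
    finally show "L X $$ (k, l) = (choi_map d A X + transpose_mat (choi_map d B X)) $$ (k, l)" .
  qed (use LX in \<open>auto simp: choi_map_def\<close>)
qed

section \<open>The linear program\<close>

text \<open>Places \<open>v_vec\<close> in the column space of \<open>V_mat\<close> without
  inverting that matrix, so that a row annihilated by \<open>V_mat\<close> from the right is
  orthogonal to \<open>v_vec\<close>.\<close>

lemma v_vec_generating_function:
  assumes d: "2 \<le> d"
  obtains x y where "\<And>l. l < m + 1 \<Longrightarrow> v_vec d m p $ l = (\<Sum>b<m + 1. V_mat d m $$ (l, b) * (x ^ b * y ^ (m - b)))"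
proof -
  let ?r = "werner_ratio d"
  \<comment> \<open>Together with \<open>y = p - x\<close> this solves \<open>x + y = p\<close> and
    \<open>?r * x - y = ?r * (1 - p)\<close>, the two numbers whose powers make up
    \<open>v_vec\<close>.\<close>
  define x where "x = (?r * (1 - p) + p) / (?r + 1)"
  have "?r + 1 > 0" using d by (simp add: werner_ratio_def add_pos_pos)
  then have "(?r + 1) * x = ?r * (1 - p) + p" by (simp add: x_def)
  then have *: "?r * x - (p - x) = ?r * (1 - p)" by (simp add: algebra_simps)
  have "v_vec d m p $ l = (\<Sum>b<m + 1. V_mat d m $$ (l, b) * (x ^ b * (p - x) ^ (m - b)))"
    if "l < m + 1" for l
    using that unfolding V_mat_generating_function[OF that] *
    by (simp add: v_vec_def power_mult_distrib flip: werner_ratio_def)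
  then show ?thesis by (rule that)
qed

text \<open>At \<open>x = d - 1\<close>, \<open>y = 1\<close> the linear forms
  \<open>werner_ratio d * x - y\<close> and \<open>x + y\<close> both equal \<open>d\<close>, so all
  rows give the same value. The weights are positive, so the row totals of \<open>q\<close> become
  nonnegative combinations of the constraints.\<close>

lemma sum_V_mat_powers:
  assumes d: "2 \<le> d" and l: "l < m + 1"
  shows "(\<Sum>b<m + 1. V_mat d m $$ (l, b) * (real d - 1) ^ b) = real d ^ m"
proof -
  have "werner_ratio d * (real d - 1) - 1 = real d" using d by (simp add: werner_ratio_def)
  then show ?thesis
    using V_mat_generating_function[OF l, of d "real d - 1" 1] l
    by (simp flip: power_add)
qed

text \<open>The homogeneous constraints, for functions instead of matrices, as \<open>farkas\<close>
  takes them.\<close>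

definition lp_cone :: "nat \<Rightarrow> nat \<Rightarrow> nat \<Rightarrow> (nat \<Rightarrow> nat \<Rightarrow> real) \<Rightarrow> bool" where
  "lp_cone d n m q \<longleftrightarrow> (\<forall>i<n + 1. \<forall>j<m + 1.
     0 \<le> (\<Sum>l<m + 1. q i l * V_mat d m $$ (l, j)) \<and>
     0 \<le> (\<Sum>k<n + 1. q k j * V_mat d n $$ (k, i)))"

definition lp_objective :: "nat \<Rightarrow> nat \<Rightarrow> nat \<Rightarrow> real \<Rightarrow> real \<Rightarrow> (nat \<Rightarrow> nat \<Rightarrow> real) \<Rightarrow> real" where
  "lp_objective d n m p1 p2 q = (\<Sum>k<n + 1. \<Sum>l<m + 1. v_vec d n p1 $ k * v_vec d m p2 $ l * q k l)"

lemma lp_feasible_iff: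
  "Q \<in> lp_feasible d n m \<longleftrightarrow> Q \<in> carrier_mat (n + 1) (m + 1) \<and> lp_cone d n m (\<lambda>k l. Q $$ (k, l)) \<and>
     (\<Sum>k<n + 1. \<Sum>l<m + 1. Q $$ (k, l)) = 1"
proof -
  have "(Q * V_mat d m) $$ (i, j) = (\<Sum>l<m + 1. Q $$ (i, l) * V_mat d m $$ (l, j))"
    "(transpose_mat Q * V_mat d n) $$ (j, i) = (\<Sum>k<n + 1. Q $$ (k, j) * V_mat d n $$ (k, i))"
    if "Q \<in> carrier_mat (n + 1) (m + 1)" "i < n + 1" "j < m + 1" for i j
  proof -
    have V: "V_mat d m \<in> carrier_mat (m + 1) (m + 1)" "V_mat d n \<in> carrier_mat (n + 1) (n + 1)"
      by (simp_all add: V_mat_def)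
    show "(Q * V_mat d m) $$ (i, j) = (\<Sum>l<m + 1. Q $$ (i, l) * V_mat d m $$ (l, j))"
      using that carrier_matD[OF V(1)] by (simp add: scalar_prod_def atLeast0LessThan)
    show "(transpose_mat Q * V_mat d n) $$ (j, i) = (\<Sum>k<n + 1. Q $$ (k, j) * V_mat d n $$ (k, i))"
      using that carrier_matD[OF V(2)] by (simp add: scalar_prod_def atLeast0LessThan)
  qed
  then show ?thesis by (auto simp: lp_feasible_def lp_cone_def)
qed

text \<open>In \<open>ereal\<close> an infimum is nonnegative iff all members are, so attainment,
  boundedness and an empty feasible set raise no questions.\<close>

lemma lp_value_nonneg_iff:
  "0 \<le> lp_value d n m p1 p2
    \<longleftrightarrow> (\<forall>Q\<in>lp_feasible d n m. 0 \<le> lp_objective d n m p1 p2 (\<lambda>k l. Q $$ (k, l)))"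
proof -
  have "v_vec d n p1 \<bullet> (Q *\<^sub>v v_vec d m p2) = lp_objective d n m p1 p2 (\<lambda>k l. Q $$ (k, l))"
    if "Q \<in> lp_feasible d n m" for Q
  proof -
    have Q: "Q \<in> carrier_mat (n + 1) (m + 1)" using that by (simp add: lp_feasible_def)
    have v: "v_vec d m p2 \<in> carrier_vec (m + 1)" by (simp add: v_vec_def)
    have "v_vec d n p1 \<bullet> (Q *\<^sub>v v_vec d m p2) = (\<Sum>k<n + 1. v_vec d n p1 $ k * (Q *\<^sub>v v_vec d m p2) $ k)"
      using Q by (simp add: scalar_prod_def atLeast0LessThan)
    also have "\<dots> = (\<Sum>k<n + 1. v_vec d n p1 $ k * (\<Sum>l<m + 1. Q $$ (k, l) * v_vec d m p2 $ l))"
      using Q v by (intro sum.cong refl) (simp add: scalar_prod_def atLeast0LessThan)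
    finally show ?thesis by (simp add: lp_objective_def sum_distrib_left mult_ac)
  qed
  then show ?thesis by (simp add: lp_value_def le_INF_iff)
qed

text \<open>The normalization \<open>\<Sum> Q = 1\<close> costs nothing: on the cone the total is nonnegative, and where
  it vanishes all constraints are tight, which forces the objective to vanish.\<close>

lemma lp_objective_nonneg_on_cone:
  assumes d: "2 \<le> d"
    and feas: "\<forall>Q\<in>lp_feasible d n m. 0 \<le> lp_objective d n m p1 p2 (\<lambda>k l. Q $$ (k, l))"
    and q: "lp_cone d n m q"
  shows "0 \<le> lp_objective d n m p1 p2 q"
proof -
  define w where "w k j = (\<Sum>l<m + 1. q k l * V_mat d m $$ (l, j))" for k j
  define R where "R k = (\<Sum>l<m + 1. q k l)" for k
  have w: "0 \<le> w k j" if "k < n + 1" "j < m + 1" for k j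
    using q that unfolding lp_cone_def w_def by blast
  have d1: "0 < (real d - 1) ^ j" for j using d by simp
  \<comment> \<open>A positive combination of the constraints of row \<open>k\<close> is a positive
    multiple of its total; hence the total is nonnegative, and if it is 0 then so are all
    \<open>w k j\<close>.\<close>
  have wR: "(\<Sum>j<m + 1. w k j * (real d - 1) ^ j) = real d ^ m * R k" for k
  proof -
    have "(\<Sum>j<m + 1. w k j * (real d - 1) ^ j)
      = (\<Sum>l<m + 1. q k l * (\<Sum>j<m + 1. V_mat d m $$ (l, j) * (real d - 1) ^ j))"
      unfolding w_def sum_distrib_left sum_distrib_right by (subst sum.swap) (simp add: mult.assoc)
    also have "\<dots> = (\<Sum>l<m + 1. q k l * real d ^ m)"
      using sum_V_mat_powers[OF d] by (intro sum.cong refl arg_cong2[where f = "(*)"]) blast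
    finally show ?thesis by (simp add: R_def sum_distrib_left mult.commute)
  qed
  have dm: "0 < real d ^ m" using d by simp
  have R: "0 \<le> R k" if "k < n + 1" for k
  proof -
    have "0 \<le> (\<Sum>j<m + 1. w k j * (real d - 1) ^ j)"
      using w[OF that] d1 by (intro sum_nonneg mult_nonneg_nonneg) (auto intro: less_imp_le)
    then show ?thesis unfolding wR using dm by (simp add: zero_le_mult_iff)
  qed
  define S where "S = (\<Sum>k<n + 1. R k)"
  have "0 \<le> S" unfolding S_def using R by (intro sum_nonneg) simp
  then consider "0 < S" | "S = 0" by linarith
  then show ?thesis
  proof cases
    case 1
    define Q where "Q = mat (n + 1) (m + 1) (\<lambda>(k, l). q k l / S)"
    have Q: "Q $$ (k, l) = q k l / S" if "k < n + 1" "l < m + 1" for k l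
      using that by (simp add: Q_def)
    have "(\<Sum>k<n + 1. \<Sum>l<m + 1. Q $$ (k, l)) = S / S"
      unfolding S_def R_def sum_divide_distrib by (intro sum.cong refl) (simp add: Q S_def R_def)
    moreover have "lp_cone d n m (\<lambda>k l. Q $$ (k, l))"
      unfolding lp_cone_def
    proof (intro allI impI)
      fix i j assume ij: "i < n + 1" "j < m + 1"
      have "(\<Sum>l<m + 1. Q $$ (i, l) * V_mat d m $$ (l, j)) = (\<Sum>l<m + 1. q i l * V_mat d m $$ (l, j)) / S"
        unfolding sum_divide_distrib using ij by (intro sum.cong refl) (simp add: Q)
      moreover have "(\<Sum>k<n + 1. Q $$ (k, j) * V_mat d n $$ (k, i)) = (\<Sum>k<n + 1. q k j * V_mat d n $$ (k, i)) / S"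
        unfolding sum_divide_distrib using ij by (intro sum.cong refl) (simp add: Q)
      ultimately show "0 \<le> (\<Sum>l<m + 1. Q $$ (i, l) * V_mat d m $$ (l, j)) \<and>
          0 \<le> (\<Sum>k<n + 1. Q $$ (k, j) * V_mat d n $$ (k, i))"
        using q ij 1 unfolding lp_cone_def by simp
    qed
    ultimately have "Q \<in> lp_feasible d n m"
      using 1 unfolding lp_feasible_iff by (simp add: Q_def)
    then have "0 \<le> lp_objective d n m p1 p2 (\<lambda>k l. Q $$ (k, l))" using feas by blast
    also have "\<dots> = lp_objective d n m p1 p2 q / S"
      unfolding lp_objective_def sum_divide_distrib by (intro sum.cong refl) (simp add: Q)
    finally show ?thesis using 1 by (simp add: zero_le_divide_iff)
  next
    case 2
    have w0: "w k j = 0" if k: "k < n + 1" and j: "j < m + 1" for k j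
    proof -
      have "R k = 0"
        using 2 R k unfolding S_def by (subst (asm) sum_nonneg_eq_0_iff) auto
      then have "(\<Sum>j<m + 1. w k j * (real d - 1) ^ j) = 0" unfolding wR by simp
      moreover have "0 \<le> w k j * (real d - 1) ^ j" if "j < m + 1" for j
        using w[OF k that] d1[of j] by (intro mult_nonneg_nonneg) auto
      ultimately have "w k j * (real d - 1) ^ j = 0"
        using j by (subst (asm) sum_nonneg_eq_0_iff) auto
      then show ?thesis using d by simp
    qed
    \<comment> \<open>This expresses row \<open>k\<close> of the objective by the vanishing numbers
      \<open>w k b\<close>.\<close>
    obtain x y where v: "\<And>l. l < m + 1 \<Longrightarrow>
        v_vec d m p2 $ l = (\<Sum>b<m + 1. V_mat d m $$ (l, b) * (x ^ b * y ^ (m - b)))"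
      by (rule v_vec_generating_function[OF d, where m = m and p = p2]) auto
    have "(\<Sum>l<m + 1. v_vec d m p2 $ l * q k l) = 0" if k: "k < n + 1" for k
    proof -
      have "(\<Sum>l<m + 1. v_vec d m p2 $ l * q k l)
        = (\<Sum>l<m + 1. \<Sum>b<m + 1. q k l * V_mat d m $$ (l, b) * (x ^ b * y ^ (m - b)))"
        by (intro sum.cong refl) (simp add: v sum_distrib_left sum_distrib_right mult_ac)
      also have "\<dots> = (\<Sum>b<m + 1. w k b * (x ^ b * y ^ (m - b)))"
        unfolding w_def sum_distrib_right by (rule sum.swap)
      also have "\<dots> = 0" using w0[OF k] by (intro sum.neutral) simp
      finally show ?thesis .
    qed
    then show ?thesis
      unfolding lp_objective_def mult.assoc sum_distrib_left[symmetric] by simp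
  qed
qed

lemma lp_dual_certificate:
  assumes "\<And>q. lp_cone d n m q \<Longrightarrow> 0 \<le> lp_objective d n m p1 p2 q"
  shows "\<exists>\<alpha> \<beta> :: nat \<Rightarrow> nat \<Rightarrow> real. (\<forall>i<n + 1. \<forall>j<m + 1. 0 \<le> \<alpha> i j \<and> 0 \<le> \<beta> i j) \<and>
    (\<forall>k<n + 1. \<forall>l<m + 1. v_vec d n p1 $ k * v_vec d m p2 $ l
      = (\<Sum>j<m + 1. V_mat d m $$ (l, j) * \<alpha> k j) + (\<Sum>i<n + 1. V_mat d n $$ (k, i) * \<beta> i l))"
proof -
  let ?I = "{..<n + 1} \<times> {..<m + 1}"
  \<comment> \<open>\<open>True\<close> marks the constraints from \<open>Q V\<close>,
    \<open>False\<close> those from the transposed matrix. The variable \<open>(k, l)\<close> occurs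
    in the former when \<open>i = k\<close> and in the latter when \<open>j = l\<close>.\<close>
  define g where "g s t = (case s of (c, i, j) \<Rightarrow> case t of (k, l) \<Rightarrow>
     if c then (if k = i then V_mat d m $$ (l, j) else 0) else (if l = j then V_mat d n $$ (k, i) else 0))"
    for s :: "bool \<times> nat \<times> nat" and t :: "nat \<times> nat"
  define c where "c t = v_vec d n p1 $ fst t * v_vec d m p2 $ snd t" for t
  have g1: "(\<Sum>t\<in>?I. g (True, i, j) t * x t) = (\<Sum>l<m + 1. x (i, l) * V_mat d m $$ (l, j))"
    if "i < n + 1" for i j x
  proof -
    have "(\<Sum>t\<in>?I. g (True, i, j) t * x t)
      = (\<Sum>k<n + 1. if k = i then \<Sum>l<m + 1. x (i, l) * V_mat d m $$ (l, j) else 0)"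
      unfolding sum.cartesian_product' by (intro sum.cong refl) (simp add: g_def mult.commute)
    then show ?thesis using that by simp
  qed
  have g2: "(\<Sum>t\<in>?I. g (False, i, j) t * x t) = (\<Sum>k<n + 1. x (k, j) * V_mat d n $$ (k, i))"
    if "j < m + 1" for i j x
  proof -
    have "(\<Sum>t\<in>?I. g (False, i, j) t * x t)
      = (\<Sum>k<n + 1. \<Sum>l<m + 1. if l = j then x (k, j) * V_mat d n $$ (k, i) else 0)"
      unfolding sum.cartesian_product' by (intro sum.cong refl) (simp add: g_def mult.commute)
    then show ?thesis using that by simp
  qed
  have "\<exists>w. (\<forall>s\<in>UNIV \<times> ?I. 0 \<le> w s) \<and> (\<forall>t\<in>?I. c t = (\<Sum>s\<in>UNIV \<times> ?I. w s * g s t))"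
  proof (rule farkas)
    fix x :: "nat \<times> nat \<Rightarrow> real"
    assume x: "\<forall>s\<in>UNIV \<times> ?I. 0 \<le> (\<Sum>t\<in>?I. g s t * x t)"
    have "lp_cone d n m (\<lambda>k l. x (k, l))"
      unfolding lp_cone_def
    proof (intro allI impI conjI)
      fix i j assume ij: "i < n + 1" "j < m + 1"
      show "0 \<le> (\<Sum>l<m + 1. x (i, l) * V_mat d m $$ (l, j))"
        unfolding g1[OF ij(1), symmetric] using ij by (intro x[rule_format]) simp
      show "0 \<le> (\<Sum>k<n + 1. x (k, j) * V_mat d n $$ (k, i))"
        unfolding g2[OF ij(2), symmetric] using ij by (intro x[rule_format]) simp
    qed
    then have "0 \<le> lp_objective d n m p1 p2 (\<lambda>k l. x (k, l))" by (rule assms)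
    then show "0 \<le> (\<Sum>t\<in>?I. c t * x t)"
      unfolding sum.cartesian_product' by (simp add: lp_objective_def c_def)
  qed (intro finite_cartesian_product finite_lessThan finite)+
  then obtain w where w: "\<forall>s\<in>UNIV \<times> ?I. 0 \<le> w s"
    and c: "\<forall>t\<in>?I. c t = (\<Sum>s\<in>UNIV \<times> ?I. w s * g s t)" by (elim exE conjE)
  show ?thesis
  proof (rule exI[of _ "\<lambda>i j. w (True, i, j)"], rule exI[of _ "\<lambda>i j. w (False, i, j)"], rule conjI;
      intro allI impI)
    show "0 \<le> w (True, i, j) \<and> 0 \<le> w (False, i, j)" if "i < n + 1" "j < m + 1" for i j
      using that by (intro conjI bspec[OF w]) simp_all
    fix k l assume kl: "k < n + 1" "l < m + 1"
    have "v_vec d n p1 $ k * v_vec d m p2 $ l = (\<Sum>s\<in>UNIV \<times> ?I. w s * g s (k, l))"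
      using bspec[OF c, of "(k, l)", unfolded c_def fst_conv snd_conv] kl by blast
    also have "\<dots> = (\<Sum>i<n + 1. \<Sum>j<m + 1. w (True, i, j) * g (True, i, j) (k, l))
      + (\<Sum>i<n + 1. \<Sum>j<m + 1. w (False, i, j) * g (False, i, j) (k, l))"
      unfolding sum.cartesian_product' UNIV_bool by simp
    also have "(\<Sum>i<n + 1. \<Sum>j<m + 1. w (True, i, j) * g (True, i, j) (k, l))
      = (\<Sum>i<n + 1. if i = k then \<Sum>j<m + 1. V_mat d m $$ (l, j) * w (True, k, j) else 0)"
      by (intro sum.cong refl) (simp add: g_def mult.commute)
    also have "(\<Sum>i<n + 1. \<Sum>j<m + 1. w (False, i, j) * g (False, i, j) (k, l))
      = (\<Sum>i<n + 1. \<Sum>j<m + 1. if j = l then V_mat d n $$ (k, i) * w (False, i, l) else 0)"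
      by (intro sum.cong refl) (simp add: g_def mult.commute)
    also have "(\<Sum>i<n + 1. if i = k then \<Sum>j<m + 1. V_mat d m $$ (l, j) * w (True, k, j) else 0)
      = (\<Sum>j<m + 1. V_mat d m $$ (l, j) * w (True, k, j))"
      using kl by simp
    also have "(\<Sum>i<n + 1. \<Sum>j<m + 1. if j = l then V_mat d n $$ (k, i) * w (False, i, l) else 0)
      = (\<Sum>i<n + 1. V_mat d n $$ (k, i) * w (False, i, l))"
      using kl by simp
    finally show "v_vec d n p1 $ k * v_vec d m p2 $ l
      = (\<Sum>j<m + 1. V_mat d m $$ (l, j) * w (True, k, j)) + (\<Sum>i<n + 1. V_mat d n $$ (k, i) * w (False, i, l))" .
  qed
qed

section \<open>Werner maps\<close>

text \<open>Labels are \<open>False\<close> for \<open>P_sym\<close> and \<open>\<omega>/d\<close>, \<open>True\<close> for \<open>P_asym\<close> and \<open>1 - \<omega>/d\<close>. The scaling of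
  \<open>iso_op\<close> makes its expansion in the partial transposes of \<open>sym_op\<close> have exactly the coefficients
  \<open>label_coeff\<close>; \<open>dual_sym_op\<close> is scaled so that its own expansion has the transposed ones.\<close>

definition sym_op :: "bool \<Rightarrow> real biop" where
  "sym_op a = flip_op (1 / 2) (if a then - 1 / 2 else 1 / 2)"

definition iso_op :: "nat \<Rightarrow> bool \<Rightarrow> real biop" where
  "iso_op d b = (if b then omega_op (real d / (real d - 1)) (- 1 / (real d - 1)) else omega_op 0 1)"

definition werner_op :: "nat \<Rightarrow> real \<Rightarrow> real biop" where
  "werner_op d p x y = p / d_sym d * sym_op False x y + (1 - p) / d_asym d * sym_op True x y"

definition dual_sym_op :: "nat \<Rightarrow> bool \<Rightarrow> real biop" where
  "dual_sym_op d a x y = (if a then werner_ratio d else 1) * sym_op a x y"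

text \<open>Read off from the row \<open>a = False\<close>: the coefficients of
  \<open>(1 + omega) / 2\<close>, the partial transpose of \<open>P_sym\<close>, in the operators
  \<open>iso_op\<close>.\<close>

definition iso_weight :: "nat \<Rightarrow> bool \<Rightarrow> real" where
  "iso_weight d b = (if b then (real d - 1) / (2 * real d) else (real d + 1) / (2 * real d))"

lemma omega_op_linear: "omega_op a b x y = a * omega_op 1 0 x y + b * omega_op 0 1 x y"
  by (simp add: omega_op_def)

lemma omega_op_scale: "k * omega_op a b x y = omega_op (k * a) (k * b) x y"
  by (simp add: omega_op_def distrib_left)

lemma flip_op_linear: "flip_op a b x y = a * flip_op 1 0 x y + b * flip_op 0 1 x y"
  by (simp add: flip_op_def)

lemma is_projection_flip_op:
  assumes "a * a + b * b = a" "a * b + b * a = b"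
  shows "is_projection d (flip_op a b)"
  unfolding is_projection_def
proof (intro ballI conjI flip_op_sym)
  fix x y assume "x \<in> square d" "y \<in> square d"
  then show "(\<Sum>q\<in>square d. flip_op a b x q * flip_op a b q y) = flip_op a b x y"
    by (simp only: flip_op_comp assms)
qed

lemma is_projection_omega_op:
  assumes "a * a = a" "a * b + b * a + real d * b * b = b"
  shows "is_projection d (omega_op a b)"
  unfolding is_projection_def
proof (intro ballI conjI omega_op_sym)
  fix x y assume "x \<in> square d" "y \<in> square d"
  then show "(\<Sum>q\<in>square d. omega_op a b x q * omega_op a b q y) = omega_op a b x y"
    by (simp only: omega_op_comp assms)
qed

lemma scaled_projection_sym_op: "scaled_projection d (sym_op a)"
proof -
  have "is_projection d (sym_op a)"
    unfolding sym_op_def by (rule is_projection_flip_op) auto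
  then show ?thesis unfolding scaled_projection_def
    by (intro exI[of _ 1] exI[of _ "sym_op a"]) simp
qed

lemma scaled_projection_iso_op:
  assumes d: "2 \<le> d"
  shows "scaled_projection d (iso_op d b)"
proof (cases b)
  case True
  have "is_projection d (omega_op 1 (- 1 / real d))"
    using d by (intro is_projection_omega_op) (auto simp: field_simps)
  moreover have "iso_op d b x y = real d / (real d - 1) * omega_op 1 (- 1 / real d) x y" for x y
    using True d by (simp add: iso_op_def omega_op_scale)
  moreover have "0 \<le> real d / (real d - 1)" using d by simp
  ultimately show ?thesis unfolding scaled_projection_def by blast
next
  case False
  have "is_projection d (omega_op 0 (1 / real d))"
    using d by (intro is_projection_omega_op) (auto simp: field_simps)
  moreover have "iso_op d b x y = real d * omega_op 0 (1 / real d) x y" for x y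
    using False d by (simp add: iso_op_def omega_op_scale)
  moreover have "0 \<le> real d" by simp
  ultimately show ?thesis unfolding scaled_projection_def by blast
qed

lemma scaled_projection_dual_sym_op:
  assumes d: "2 \<le> d"
  shows "scaled_projection d (dual_sym_op d a)"
proof -
  have "0 \<le> (if a then werner_ratio d else 1)" using d by (simp add: werner_ratio_def)
  from scaled_projection_scale[OF scaled_projection_sym_op this]
  show ?thesis by (simp add: dual_sym_op_def[abs_def])
qed

text \<open>\<open>omega\<close> is the difference of the partial transposes of \<open>P_sym\<close>
  and \<open>P_asym\<close>. With \<open>r\<close> the ratio, \<open>d / (d - 1)\<close> times
  \<open>1 - omega / d\<close> is the first plus \<open>r\<close> times the second, since
  \<open>1 + r = 2 d / (d - 1)\<close> and \<open>1 - r = - 2 / (d - 1)\<close>.\<close>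

lemma iso_op_eq:
  assumes d: "2 \<le> d"
  shows "iso_op d b = (\<lambda>x y. \<Sum>a\<in>UNIV. label_coeff d a b * partial_transpose (sym_op a) x y)"
proof (intro ext)
  fix x y
  have d1: "real d - 1 \<noteq> 0" using d by simp
  define u v where "u = omega_op 1 0 x y" and "v = omega_op 0 1 x y"
  have O: "omega_op a b x y = a * u + b * v" for a b
    unfolding u_def v_def by (rule omega_op_linear)
  show "iso_op d b x y = (\<Sum>a\<in>UNIV. label_coeff d a b * partial_transpose (sym_op a) x y)"
  proof (cases b)
    case True
    then show ?thesis using d1
      by (simp add: UNIV_bool sym_op_def iso_op_def label_coeff_def O werner_ratio_def divide_simps)
        (simp add: algebra_simps)
  next
    case False
    then show ?thesis
      by (simp add: UNIV_bool sym_op_def iso_op_def label_coeff_def O field_simps)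
  qed
qed

lemma partial_transpose_iso_op:
  assumes d: "2 \<le> d"
  shows "partial_transpose (iso_op d b) = (\<lambda>x y. \<Sum>a\<in>UNIV. label_coeff d a b * sym_op a x y)"
proof (intro ext)
  fix x y
  have "partial_transpose (iso_op d b) x y
    = (\<Sum>a\<in>UNIV. label_coeff d a b * partial_transpose (partial_transpose (sym_op a)) x y)"
    unfolding iso_op_eq[OF d] by (simp add: partial_transpose_def)
  then show "partial_transpose (iso_op d b) x y = (\<Sum>a\<in>UNIV. label_coeff d a b * sym_op a x y)"
    by simp
qed

text \<open>Here \<open>a\<close> is given and \<open>b\<close> is summed, so expanding a weighted
  sum of products contracts \<open>V_mat\<close> over its row index, as \<open>Q V\<close>
  does.\<close>

lemma partial_transpose_dual_sym_op:
  assumes d: "2 \<le> d"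
  shows "partial_transpose (dual_sym_op d a)
    = (\<lambda>x y. \<Sum>b\<in>UNIV. label_coeff d a b * (iso_weight d b * iso_op d b x y))"
proof (intro ext)
  fix x y
  have d1: "real d - 1 \<noteq> 0" "real d \<noteq> 0" using d by simp_all
  define u v where "u = omega_op 1 0 x y" and "v = omega_op 0 1 x y"
  have O: "omega_op a b x y = a * u + b * v" for a b
    unfolding u_def v_def by (rule omega_op_linear)
  have "partial_transpose (dual_sym_op d a) x y
    = (if a then werner_ratio d else 1) * partial_transpose (sym_op a) x y"
    by (simp add: partial_transpose_def dual_sym_op_def)
  also have "\<dots> = (\<Sum>b\<in>UNIV. label_coeff d a b * (iso_weight d b * iso_op d b x y))"
  proof (cases a)
    case True
    then show ?thesis using d1
      by (simp add: UNIV_bool sym_op_def iso_op_def label_coeff_def iso_weight_def O werner_ratio_def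
          divide_simps) (simp add: algebra_simps)
  next
    case False
    then show ?thesis using d1
      by (simp add: UNIV_bool sym_op_def iso_op_def label_coeff_def iso_weight_def O divide_simps)
        (simp add: algebra_simps)
  qed
  finally show "partial_transpose (dual_sym_op d a) x y
    = (\<Sum>b\<in>UNIV. label_coeff d a b * (iso_weight d b * iso_op d b x y))" .
qed

text \<open>The contribution of one site to an entry of \<open>v_vec\<close>.\<close>

definition werner_weight :: "nat \<Rightarrow> real \<Rightarrow> bool \<Rightarrow> real" where
  "werner_weight d p a = (if a then werner_ratio d * (1 - p) else p)"

lemma werner_op_eq:
  assumes d: "2 \<le> d"
  shows "werner_op d p x y = 1 / d_sym d * (\<Sum>a\<in>UNIV. werner_weight d p a * sym_op a x y)"
proof -
  have "(1 - p) / d_asym d = 1 / d_sym d * (werner_ratio d * (1 - p))"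
    using d by (simp add: d_sym_def d_asym_def werner_ratio_def divide_simps)
  then show ?thesis
    by (simp add: werner_op_def UNIV_bool werner_weight_def distrib_left)
qed

text \<open>\<open>P_sym\<close> and \<open>P_asym\<close> are orthogonal with traces
  \<open>d_sym d\<close> and \<open>d_asym d\<close>, so a Werner operator pairs with them to
  \<open>p\<close> and \<open>1 - p\<close>; the ratio built into \<open>dual_sym_op\<close>
  supplies the rest.\<close>

lemma trace_pairing_werner_op:
  assumes d: "2 \<le> d"
  shows "trace_pairing d (dual_sym_op d a) (werner_op d p) = werner_weight d p a"
proof -
  define s1 s2 where "s1 = p / d_sym d" and "s2 = (1 - p) / d_asym d"
  have pos: "d_sym d > 0" "d_asym d > 0" using d by (simp_all add: d_sym_def d_asym_def)
  have r: "werner_ratio d * d_asym d = d_sym d"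
    using d by (simp add: d_sym_def d_asym_def werner_ratio_def)
  have W: "werner_op d p = flip_op ((s1 + s2) / 2) ((s1 - s2) / 2)"
  proof (intro ext)
    fix x y
    show "werner_op d p x y = flip_op ((s1 + s2) / 2) ((s1 - s2) / 2) x y"
      unfolding werner_op_def sym_op_def s1_def[symmetric] s2_def[symmetric]
      by (subst (1 2 3) flip_op_linear) (simp add: algebra_simps add_divide_distrib diff_divide_distrib)
  qed
  have T: "dual_sym_op d a = flip_op ((if a then werner_ratio d else 1) / 2)
      ((if a then - werner_ratio d else 1) / 2)"
  proof (intro ext)
    fix x y
    show "dual_sym_op d a x y = flip_op ((if a then werner_ratio d else 1) / 2)
      ((if a then - werner_ratio d else 1) / 2) x y"
      unfolding dual_sym_op_def sym_op_def by (subst (1 2) flip_op_linear) (simp add: algebra_simps)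
  qed
  show ?thesis
  proof (cases a)
    case True
    then have "trace_pairing d (dual_sym_op d a) (werner_op d p) = werner_ratio d * (s2 * d_asym d)"
      unfolding W T trace_pairing_flip_op by (simp add: d_asym_def field_simps)
    then show ?thesis using True pos by (simp add: s2_def werner_weight_def)
  next
    case False
    then have "trace_pairing d (dual_sym_op d a) (werner_op d p) = s1 * d_sym d"
      unfolding W T trace_pairing_flip_op by (simp add: d_sym_def field_simps)
    then show ?thesis using False pos by (simp add: s1_def werner_weight_def)
  qed
qed

lemma werner_choi_entry:
  assumes "i < d" "j < d" "k < d" "l < d"
  shows "werner_choi d p $$ (i * d + k, j * d + l) = complex_of_real (werner_op d p (i, k) (j, l))"
proof -
  have eq: "i * d + k = a * d + e \<longleftrightarrow> i = a \<and> k = e" if "e < d" "k < d" for i k a e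
    using that by (metis div_mult_self3 add.right_neutral div_less mod_mult_self3 mod_less
        gr_implies_not0)
  have F: "flip_matrix d $$ (i * d + k, j * d + l) = (if i = l \<and> k = j then 1 else 0)"
    using assms eq[of j k i l] by (simp add: flip_matrix_def index_bound)
  have one: "1\<^sub>m (d * d) $$ (i * d + k, j * d + l) = (if i = j \<and> k = l then 1 else 0 :: complex)"
    using assms eq[of l k i j] by (simp add: index_bound)
  have Fc: "flip_matrix d \<in> carrier_mat (d * d) (d * d)" by (simp add: flip_matrix_def)
  have ib: "i * d + k < d * d" "j * d + l < d * d" using assms by (simp_all add: index_bound)
  define e f where "e = (if i = j \<and> k = l then 1 else 0 :: real)" and "f = (if i = l \<and> k = j then 1 else 0 :: real)"
  have P: "P_sym d $$ (r, c) = 1 / 2 * (1\<^sub>m (d * d) $$ (r, c) + flip_matrix d $$ (r, c))"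
    "P_asym d $$ (r, c) = 1 / 2 * (1\<^sub>m (d * d) $$ (r, c) - flip_matrix d $$ (r, c))"
    if "r < d * d" "c < d * d" for r c
    using that carrier_matD[OF Fc] by (simp_all add: P_sym_def P_asym_def)
  have ef: "(if i = j \<and> k = l then 1 else 0 :: complex) = complex_of_real e"
    "(if i = l \<and> k = j then 1 else 0 :: complex) = complex_of_real f"
    by (simp_all only: e_def f_def if_distrib[of complex_of_real] of_real_0 of_real_1)
  have "flip_op a b (i, k) (j, l) = a * e + b * f" for a b
  proof -
    have "(if (i, k) = (j, l) then a else 0) = a * e" by (simp add: e_def)
    moreover have "(if (i, k) = prod.swap (j, l) then b else 0) = b * f" by (simp add: f_def)
    ultimately show ?thesis by (simp only: flip_op_def)
  qed
  then have sym: "sym_op False (i, k) (j, l) = (e + f) / 2" "sym_op True (i, k) (j, l) = (e - f) / 2"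
    by (simp_all add: sym_op_def)
  have "P_sym d $$ (i * d + k, j * d + l) = complex_of_real (sym_op False (i, k) (j, l))"
    "P_asym d $$ (i * d + k, j * d + l) = complex_of_real (sym_op True (i, k) (j, l))"
    unfolding P[OF ib] F one ef sym by simp_all
  moreover have "P_sym d \<in> carrier_mat (d * d) (d * d)" "P_asym d \<in> carrier_mat (d * d) (d * d)"
    by (auto intro!: carrier_matI simp: P_sym_def P_asym_def flip_matrix_def)
  ultimately show ?thesis
    using ib by (simp add: werner_choi_def werner_op_def)
qed

lemma choi_op_werner:
  assumes W: "is_werner_map d p W" and "x \<in> square d" "y \<in> square d"
  shows "choi_op d W x y = complex_of_real (werner_op d p x y)"
    and "choi_op d (transpose_mat \<circ> W) x y = complex_of_real (partial_transpose (werner_op d p) x y)"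
proof -
  have lin: "linear_map d d W" and choi: "choi_matrix d W = werner_choi d p"
    using W by (simp_all add: is_werner_map_def)
  have e: "W (matrix_unit d i j) $$ (k, l) = complex_of_real (werner_op d p (i, k) (j, l))"
    if "i < d" "j < d" "k < d" "l < d" for i j k l
    using choi_matrix_entry[OF lin that] werner_choi_entry[OF that] by (simp add: choi)
  have c: "W (matrix_unit d i j) \<in> carrier_mat d d" for i j
    using lin by (simp add: linear_map_def)
  show "choi_op d W x y = complex_of_real (werner_op d p x y)"
    using assms(2,3) by (simp add: choi_op_def e square_def mem_Times_iff)
  show "choi_op d (transpose_mat \<circ> W) x y = complex_of_real (partial_transpose (werner_op d p) x y)"
    using assms(2,3) carrier_matD[OF c]
    by (simp add: choi_op_def e square_def mem_Times_iff partial_transpose_def)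
qed

lemma linear_map_transpose:
  assumes L: "linear_map d e L"
  shows "linear_map d e (transpose_mat \<circ> L)"
proof -
  have add: "transpose_mat (A + B) = transpose_mat A + transpose_mat B"
    if "A \<in> carrier_mat e e" "B \<in> carrier_mat e e" for A B :: "complex mat"
    using that by (auto intro!: eq_matI)
  have smult: "transpose_mat (c \<cdot>\<^sub>m A) = c \<cdot>\<^sub>m transpose_mat A" for A :: "complex mat" and c
    by (auto intro!: eq_matI)
  show ?thesis using L unfolding linear_map_def by (simp add: add smult)
qed

section \<open>Sums of products of labelled operators\<close>

text \<open>A label is a pair of sets: the first one marks sites among the \<open>n\<close> leading factors, which
  carry the high digits, the second one sites among the \<open>m\<close> trailing factors.\<close>

definition labels :: "nat \<Rightarrow> nat \<Rightarrow> (nat set \<times> nat set) set" where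
  "labels n m = Pow {m..<n + m} \<times> Pow {..<m}"

definition labelled_op ::
  "nat \<Rightarrow> nat \<Rightarrow> nat \<Rightarrow> (bool \<Rightarrow> real biop) \<Rightarrow> (bool \<Rightarrow> real biop) \<Rightarrow> nat set \<times> nat set \<Rightarrow> real biop" where
  "labelled_op d n m F1 F2 s =
     tensor_op d {..<n + m} (\<lambda>i. if i < m then F2 (i \<in> snd s) else F1 (i \<in> fst s))"

lemma finite_labels [simp]: "finite (labels n m)"
  by (simp add: labels_def)

lemma labels_card:
  assumes "s \<in> labels n m"
  shows "card (fst s) < n + 1" "card (snd s) < m + 1"
proof -
  have "card (fst s) \<le> card {m..<n + m}" "card (snd s) \<le> card {..<m}"
    using assms by (intro card_mono; auto simp: labels_def)+
  then show "card (fst s) < n + 1" "card (snd s) < m + 1" by simp_all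
qed

lemma prod_sites:
  fixes f :: "nat \<Rightarrow> real"
  shows "(\<Prod>i<n + m. f i) = (\<Prod>i\<in>{m..<n + m}. f i) * (\<Prod>i<m. f i)"
proof -
  have "{..<n + m} = {m..<n + m} \<union> {..<m}" by auto
  then have "(\<Prod>i<n + m. f i) = (\<Prod>i\<in>{m..<n + m} \<union> {..<m}. f i)" by (rule arg_cong)
  also have "\<dots> = (\<Prod>i\<in>{m..<n + m}. f i) * (\<Prod>i<m. f i)"
    by (rule prod.union_disjoint) auto
  finally show ?thesis .
qed

lemma labelled_op_eq:
  "labelled_op d n m F1 F2 (A, B) x y
    = (\<Prod>i\<in>{m..<n + m}. F1 (i \<in> A) (digit_pair d i x) (digit_pair d i y))
      * (\<Prod>i<m. F2 (i \<in> B) (digit_pair d i x) (digit_pair d i y))"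
  unfolding labelled_op_def tensor_op_def prod_sites
  by (intro arg_cong2[where f = "(*)"] prod.cong refl) simp_all

lemma partial_transpose_labelled_op:
  "partial_transpose (labelled_op d n m F1 F2 s)
    = labelled_op d n m (\<lambda>a. partial_transpose (F1 a)) (\<lambda>a. partial_transpose (F2 a)) s"
  unfolding labelled_op_def partial_transpose_tensor_op
  by (rule arg_cong[where f = "tensor_op d {..<n + m}"]) auto

lemma scaled_projection_labelled_op:
  assumes "0 < d" "\<And>a. scaled_projection d (F1 a)" "\<And>a. scaled_projection d (F2 a)"
  shows "scaled_projection (d ^ (n + m)) (labelled_op d n m F1 F2 s)"
  unfolding labelled_op_def using assms by (intro scaled_projection_tensor_op) auto

lemma projection_cone_labelled_sum:
  assumes "0 < d" "\<And>a. scaled_projection d (F1 a)" "\<And>a. scaled_projection d (F2 a)"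
    and "\<And>s. s \<in> labels n m \<Longrightarrow> 0 \<le> c s"
  shows "projection_cone (d ^ (n + m)) (\<lambda>x y. \<Sum>s\<in>labels n m. c s * labelled_op d n m F1 F2 s x y)"
  using assms
  by (intro projection_cone_sum[where S = "labels n m" and
        F = "\<lambda>s x y. c s * labelled_op d n m F1 F2 s x y"] scaled_projection_scale
      scaled_projection_labelled_op) auto

lemma sum_labels: "(\<Sum>s\<in>labels n m. f s) = (\<Sum>A\<in>Pow {m..<n + m}. \<Sum>B\<in>Pow {..<m}. f (A, B))"
  by (simp add: labels_def sum.cartesian_product')

lemma sum_labels': "(\<Sum>s\<in>labels n m. f s) = (\<Sum>B\<in>Pow {..<m}. \<Sum>A\<in>Pow {m..<n + m}. f (A, B))"
  unfolding sum_labels by (rule sum.swap)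

text \<open>For each \<open>A\<close> the product over the leading sites is a constant, and
  \<open>sum_label_expand\<close> on the trailing sites makes \<open>V\<close> act on the second
  argument of \<open>f\<close>.\<close>

lemma labelled_sum_expand2:
  "(\<Sum>s\<in>labels n m. f (card (fst s)) (card (snd s)) *
      labelled_op d n m F1 (\<lambda>b x y. \<Sum>a\<in>UNIV. label_coeff d a b * F2 a x y) s x y)
    = (\<Sum>s\<in>labels n m. (\<Sum>j<m + 1. V_mat d m $$ (card (snd s), j) * f (card (fst s)) j) *
      labelled_op d n m F1 F2 s x y)"
proof -
  let ?F1 = "\<lambda>A. \<Prod>i\<in>{m..<n + m}. F1 (i \<in> A) (digit_pair d i x) (digit_pair d i y)"
  let ?t = "\<lambda>i a. F2 a (digit_pair d i x) (digit_pair d i y)"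
  have "(\<Sum>B\<in>Pow {..<m}. f k (card B) * (\<Prod>i<m. \<Sum>a\<in>UNIV. label_coeff d a (i \<in> B) * ?t i a))
    = (\<Sum>B\<in>Pow {..<m}. (\<Sum>j<m + 1. V_mat d m $$ (card B, j) * f k j) * (\<Prod>i<m. ?t i (i \<in> B)))" for k
    using sum_label_expand[of "{..<m}" "f k" d ?t] by simp
  then have "(\<Sum>A\<in>Pow {m..<n + m}. ?F1 A * (\<Sum>B\<in>Pow {..<m}. f (card A) (card B) *
        (\<Prod>i<m. \<Sum>a\<in>UNIV. label_coeff d a (i \<in> B) * ?t i a)))
    = (\<Sum>A\<in>Pow {m..<n + m}. ?F1 A * (\<Sum>B\<in>Pow {..<m}. (\<Sum>j<m + 1. V_mat d m $$ (card B, j) * f (card A) j) *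
        (\<Prod>i<m. ?t i (i \<in> B))))"
    by simp
  then show ?thesis
    unfolding sum_labels labelled_op_eq fst_conv snd_conv sum_distrib_left[of "?F1 _"]
    by (simp only: mult_ac)
qed

lemma labelled_sum_expand1:
  "(\<Sum>s\<in>labels n m. f (card (fst s)) (card (snd s)) *
      labelled_op d n m (\<lambda>b x y. \<Sum>a\<in>UNIV. label_coeff d a b * F1 a x y) F2 s x y)
    = (\<Sum>s\<in>labels n m. (\<Sum>j<n + 1. V_mat d n $$ (card (fst s), j) * f j (card (snd s))) *
      labelled_op d n m F1 F2 s x y)"
proof -
  let ?F2 = "\<lambda>B. \<Prod>i<m. F2 (i \<in> B) (digit_pair d i x) (digit_pair d i y)"
  let ?t = "\<lambda>i a. F1 a (digit_pair d i x) (digit_pair d i y)"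
  have "(\<Sum>A\<in>Pow {m..<n + m}. f (card A) l * (\<Prod>i\<in>{m..<n + m}. \<Sum>a\<in>UNIV. label_coeff d a (i \<in> A) * ?t i a))
    = (\<Sum>A\<in>Pow {m..<n + m}. (\<Sum>j<n + 1. V_mat d n $$ (card A, j) * f j l) * (\<Prod>i\<in>{m..<n + m}. ?t i (i \<in> A)))" for l
    using sum_label_expand[of "{m..<n + m}" "\<lambda>k. f k l" d ?t] by simp
  then have "(\<Sum>B\<in>Pow {..<m}. ?F2 B * (\<Sum>A\<in>Pow {m..<n + m}. f (card A) (card B) *
        (\<Prod>i\<in>{m..<n + m}. \<Sum>a\<in>UNIV. label_coeff d a (i \<in> A) * ?t i a)))
    = (\<Sum>B\<in>Pow {..<m}. ?F2 B * (\<Sum>A\<in>Pow {m..<n + m}. (\<Sum>j<n + 1. V_mat d n $$ (card A, j) * f j (card B)) *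
        (\<Prod>i\<in>{m..<n + m}. ?t i (i \<in> A))))"
    by simp
  then show ?thesis
    unfolding sum_labels' labelled_op_eq fst_conv snd_conv sum_distrib_left[of "?F2 _"]
    by (simp only: mult_ac)
qed

text \<open>All labels with the same two cardinalities share one entry of \<open>Q\<close>
  evenly.\<close>

definition label_weight :: "nat \<Rightarrow> nat \<Rightarrow> nat set \<times> nat set \<Rightarrow> real" where
  "label_weight n m s = 1 / (real (n choose card (fst s)) * real (m choose card (snd s)))"

lemma labelled_sum_expand_row2:
  "(\<Sum>s\<in>labels n m. q (card (fst s)) (card (snd s)) * label_weight n m s *
      labelled_op d n m F1 (\<lambda>a x y. \<Sum>b\<in>UNIV. label_coeff d a b * H b x y) s x y)
    = (\<Sum>s\<in>labels n m. (\<Sum>l<m + 1. q (card (fst s)) l * V_mat d m $$ (l, card (snd s))) *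
      label_weight n m s * labelled_op d n m F1 H s x y)"
proof -
  let ?F1 = "\<lambda>A. (\<Prod>i\<in>{m..<n + m}. F1 (i \<in> A) (digit_pair d i x) (digit_pair d i y)) / real (n choose card A)"
  let ?t = "\<lambda>i a. H a (digit_pair d i x) (digit_pair d i y)"
  have "(\<Sum>B\<in>Pow {..<m}. q k (card B) / real (m choose card B) * (\<Prod>i<m. \<Sum>b\<in>UNIV. label_coeff d (i \<in> B) b * ?t i b))
    = (\<Sum>B\<in>Pow {..<m}. (\<Sum>l<m + 1. q k l * V_mat d m $$ (l, card B)) / real (m choose card B) * (\<Prod>i<m. ?t i (i \<in> B)))" for k
    using sum_label_expand_row[of "{..<m}" "q k" d ?t] by simp
  then have "(\<Sum>A\<in>Pow {m..<n + m}. ?F1 A * (\<Sum>B\<in>Pow {..<m}. q (card A) (card B) / real (m choose card B) *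
        (\<Prod>i<m. \<Sum>b\<in>UNIV. label_coeff d (i \<in> B) b * ?t i b)))
    = (\<Sum>A\<in>Pow {m..<n + m}. ?F1 A * (\<Sum>B\<in>Pow {..<m}. (\<Sum>l<m + 1. q (card A) l * V_mat d m $$ (l, card B)) /
        real (m choose card B) * (\<Prod>i<m. ?t i (i \<in> B))))"
    by simp
  then show ?thesis
    unfolding sum_labels labelled_op_eq fst_conv snd_conv sum_distrib_left[of "?F1 _"] label_weight_def
    by (simp add: mult_ac)
qed

lemma labelled_sum_expand_row1:
  "(\<Sum>s\<in>labels n m. q (card (fst s)) (card (snd s)) * label_weight n m s *
      labelled_op d n m (\<lambda>a x y. \<Sum>b\<in>UNIV. label_coeff d a b * H b x y) F2 s x y)
    = (\<Sum>s\<in>labels n m. (\<Sum>k<n + 1. q k (card (snd s)) * V_mat d n $$ (k, card (fst s))) *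
      label_weight n m s * labelled_op d n m H F2 s x y)"
proof -
  let ?F2 = "\<lambda>B. (\<Prod>i<m. F2 (i \<in> B) (digit_pair d i x) (digit_pair d i y)) / real (m choose card B)"
  let ?t = "\<lambda>i a. H a (digit_pair d i x) (digit_pair d i y)"
  have "(\<Sum>A\<in>Pow {m..<n + m}. q (card A) l / real (n choose card A) *
        (\<Prod>i\<in>{m..<n + m}. \<Sum>b\<in>UNIV. label_coeff d (i \<in> A) b * ?t i b))
    = (\<Sum>A\<in>Pow {m..<n + m}. (\<Sum>k<n + 1. q k l * V_mat d n $$ (k, card A)) / real (n choose card A) *
        (\<Prod>i\<in>{m..<n + m}. ?t i (i \<in> A)))" for l
    using sum_label_expand_row[of "{m..<n + m}" "\<lambda>k. q k l" d ?t] by simp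
  then have "(\<Sum>B\<in>Pow {..<m}. ?F2 B * (\<Sum>A\<in>Pow {m..<n + m}. q (card A) (card B) / real (n choose card A) *
        (\<Prod>i\<in>{m..<n + m}. \<Sum>b\<in>UNIV. label_coeff d (i \<in> A) b * ?t i b)))
    = (\<Sum>B\<in>Pow {..<m}. ?F2 B * (\<Sum>A\<in>Pow {m..<n + m}. (\<Sum>k<n + 1. q k (card B) * V_mat d n $$ (k, card A)) /
        real (n choose card A) * (\<Prod>i\<in>{m..<n + m}. ?t i (i \<in> A))))"
    by simp
  then show ?thesis
    unfolding sum_labels' labelled_op_eq fst_conv snd_conv sum_distrib_left[of "?F2 _"] label_weight_def
    by (simp add: mult_ac)
qed

lemma prod_werner_weight:
  assumes "finite I" "A \<subseteq> I"
  shows "(\<Prod>i\<in>I. werner_weight d p (i \<in> A)) = v_vec d (card I) p $ card A"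
proof -
  have "card A < card I + 1" using assms by (simp add: card_mono less_Suc_eq_le)
  then show ?thesis
    unfolding werner_weight_def prod_membership[OF assms]
    by (simp add: v_vec_def power_mult_distrib flip: werner_ratio_def)
qed

text \<open>Distributivity over the sites. The operators that appear, untransposed on the leading
  and transposed on the trailing sites, are those in which both parts of a decomposition will be
  compared with the Choi operator.\<close>

lemma werner_tensor_op:
  assumes d: "2 \<le> d"
  shows "tensor_op d {..<n + m} (\<lambda>i. if i < m then partial_transpose (werner_op d p2) else werner_op d p1) x y
    = (1 / d_sym d) ^ (n + m) * (\<Sum>s\<in>labels n m. v_vec d n p1 $ card (fst s) * v_vec d m p2 $ card (snd s) *
        labelled_op d n m sym_op (\<lambda>a. partial_transpose (sym_op a)) s x y)"
proof -
  have side: "(\<Prod>i\<in>I. 1 / d_sym d * (\<Sum>a\<in>UNIV. werner_weight d p a * t i a))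
    = (1 / d_sym d) ^ card I * (\<Sum>A\<in>Pow I. v_vec d (card I) p $ card A * (\<Prod>i\<in>I. t i (i \<in> A)))"
    if I: "finite I" for I p and t :: "nat \<Rightarrow> bool \<Rightarrow> real"
    unfolding prod.distrib prod_label_sum[OF I]
    using prod_werner_weight[OF I] by (auto intro!: arg_cong2[where f = "(*)"] sum.cong)
  have pt: "partial_transpose (werner_op d p2) x y
    = 1 / d_sym d * (\<Sum>a\<in>UNIV. werner_weight d p2 a * partial_transpose (sym_op a) x y)" for x y
    by (simp add: partial_transpose_def werner_op_eq[OF d])
  have "tensor_op d {..<n + m} (\<lambda>i. if i < m then partial_transpose (werner_op d p2) else werner_op d p1) x y
    = (\<Prod>i\<in>{m..<n + m}. werner_op d p1 (digit_pair d i x) (digit_pair d i y)) *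
      (\<Prod>i<m. partial_transpose (werner_op d p2) (digit_pair d i x) (digit_pair d i y))"
    unfolding tensor_op_def prod_sites by (intro arg_cong2[where f = "(*)"] prod.cong refl) simp_all
  also have "\<dots> = ((1 / d_sym d) ^ n * (\<Sum>A\<in>Pow {m..<n + m}. v_vec d n p1 $ card A *
        (\<Prod>i\<in>{m..<n + m}. sym_op (i \<in> A) (digit_pair d i x) (digit_pair d i y)))) *
      ((1 / d_sym d) ^ m * (\<Sum>B\<in>Pow {..<m}. v_vec d m p2 $ card B *
        (\<Prod>i<m. partial_transpose (sym_op (i \<in> B)) (digit_pair d i x) (digit_pair d i y))))"
    unfolding werner_op_eq[OF d] pt
    using side[of "{m..<n + m}" p1 "\<lambda>i a. sym_op a (digit_pair d i x) (digit_pair d i y)"]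
      side[of "{..<m}" p2 "\<lambda>i a. partial_transpose (sym_op a) (digit_pair d i x) (digit_pair d i y)"]
    by simp
  also have "\<dots> = (1 / d_sym d) ^ (n + m) * ((\<Sum>A\<in>Pow {m..<n + m}. v_vec d n p1 $ card A *
        (\<Prod>i\<in>{m..<n + m}. sym_op (i \<in> A) (digit_pair d i x) (digit_pair d i y))) *
      (\<Sum>B\<in>Pow {..<m}. v_vec d m p2 $ card B *
        (\<Prod>i<m. partial_transpose (sym_op (i \<in> B)) (digit_pair d i x) (digit_pair d i y))))"
    by (simp only: power_add mult_ac)
  finally show ?thesis
    unfolding sum_product sum_labels labelled_op_eq fst_conv snd_conv by (simp only: mult_ac)
qed

text \<open>On a trailing site both operators are partially transposed, which the trace pairing does
  not see; so every site contributes a \<open>werner_weight\<close>.\<close>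

lemma trace_labelled_op_werner:
  assumes d: "2 \<le> d" and s: "s \<in> labels n m"
  shows "trace_pairing (d ^ (n + m))
      (labelled_op d n m (dual_sym_op d) (\<lambda>a. partial_transpose (dual_sym_op d a)) s)
      (tensor_op d {..<n + m} (\<lambda>i. if i < m then partial_transpose (werner_op d p2) else werner_op d p1))
    = v_vec d n p1 $ card (fst s) * v_vec d m p2 $ card (snd s)"
proof -
  have "trace_pairing d (partial_transpose (dual_sym_op d a)) (partial_transpose (werner_op d p2))
    = werner_weight d p2 a" for a
    unfolding trace_pairing_partial_transpose by (simp add: trace_pairing_werner_op[OF d])
  then have "trace_pairing (d ^ (n + m))
      (labelled_op d n m (dual_sym_op d) (\<lambda>a. partial_transpose (dual_sym_op d a)) s)
      (tensor_op d {..<n + m} (\<lambda>i. if i < m then partial_transpose (werner_op d p2) else werner_op d p1))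
    = (\<Prod>i\<in>{m..<n + m}. werner_weight d p1 (i \<in> fst s)) * (\<Prod>i<m. werner_weight d p2 (i \<in> snd s))"
    unfolding labelled_op_def trace_pairing_tensor_op prod_sites
    by (intro arg_cong2[where f = "(*)"] prod.cong refl) (simp_all add: trace_pairing_werner_op[OF d])
  then show ?thesis
    using s prod_werner_weight[of "{m..<n + m}" "fst s" d p1] prod_werner_weight[of "{..<m}" "snd s" d p2]
    by (simp add: labels_def mem_Times_iff)
qed

lemma sum_labels_weight:
  "(\<Sum>s\<in>labels n m. q (card (fst s)) (card (snd s)) * label_weight n m s) = (\<Sum>k<n + 1. \<Sum>l<m + 1. q k l)"
proof -
  have "(\<Sum>s\<in>labels n m. q (card (fst s)) (card (snd s)) * label_weight n m s)
    = (\<Sum>A\<in>Pow {m..<n + m}. (\<Sum>B\<in>Pow {..<m}. q (card A) (card B) / real (m choose card B)) /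
        real (n choose card A))"
    by (simp add: sum_labels label_weight_def sum_divide_distrib mult.commute)
  also have "\<dots> = (\<Sum>A\<in>Pow {m..<n + m}. (\<Sum>l<m + 1. q (card A) l) / real (n choose card A))"
    using sum_Pow_card_weight[of "{..<m}" "q _"] by simp
  also have "\<dots> = (\<Sum>k<n + 1. \<Sum>l<m + 1. q k l)"
    using sum_Pow_card_weight[of "{m..<n + m}" "\<lambda>k. \<Sum>l<m + 1. q k l"] by simp
  finally show ?thesis .
qed


section \<open>Decomposability and the linear program\<close>

lemma decomposable_if_lp_nonneg:
  assumes d: "2 \<le> d"
    and L: "linear_map (d ^ (n + m)) (d ^ (n + m)) L"
    and choi: "\<And>x y. x \<in> square (d ^ (n + m)) \<Longrightarrow> y \<in> square (d ^ (n + m)) \<Longrightarrow>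
      choi_op (d ^ (n + m)) L x y = complex_of_real (tensor_op d {..<n + m}
        (\<lambda>i. if i < m then partial_transpose (werner_op d p2) else werner_op d p1) x y)"
    and lp: "0 \<le> lp_value d n m p1 p2"
  shows "decomposable (d ^ (n + m)) (d ^ (n + m)) L"
proof -
  have "\<exists>\<alpha> \<beta> :: nat \<Rightarrow> nat \<Rightarrow> real. (\<forall>i<n + 1. \<forall>j<m + 1. 0 \<le> \<alpha> i j \<and> 0 \<le> \<beta> i j) \<and>
    (\<forall>k<n + 1. \<forall>l<m + 1. v_vec d n p1 $ k * v_vec d m p2 $ l
      = (\<Sum>j<m + 1. V_mat d m $$ (l, j) * \<alpha> k j) + (\<Sum>i<n + 1. V_mat d n $$ (k, i) * \<beta> i l))"
    using lp unfolding lp_value_nonneg_iff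
    by (intro lp_dual_certificate lp_objective_nonneg_on_cone[OF d])
  then obtain \<alpha> \<beta> :: "nat \<Rightarrow> nat \<Rightarrow> real"
    where pos: "\<forall>i<n + 1. \<forall>j<m + 1. 0 \<le> \<alpha> i j \<and> 0 \<le> \<beta> i j"
    and v: "\<forall>k<n + 1. \<forall>l<m + 1. v_vec d n p1 $ k * v_vec d m p2 $ l
      = (\<Sum>j<m + 1. V_mat d m $$ (l, j) * \<alpha> k j) + (\<Sum>i<n + 1. V_mat d n $$ (k, i) * \<beta> i l)"
    by (elim exE conjE)
  \<comment> \<open>One factor \<open>1 / d_sym d\<close> for each Werner operator, as in
    \<open>werner_tensor_op\<close>.\<close>
  define \<kappa> where "\<kappa> = (1 / d_sym d) ^ (n + m)"
  have \<kappa>: "0 \<le> \<kappa>" by (simp add: \<kappa>_def d_sym_def)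
  \<comment> \<open>\<open>A\<close> has the \<open>iso_op\<close> on the trailing sites,
    \<open>B\<close> on the leading ones. Once \<open>B\<close> is partially transposed, both expand
    in the operators \<open>?L\<close> below: \<open>A\<close> by \<open>V\<close> in the second
    index, \<open>B\<close> by \<open>V\<close> in the first.\<close>
  define A where "A x y = (\<Sum>s\<in>labels n m. \<kappa> * \<alpha> (card (fst s)) (card (snd s)) *
      labelled_op d n m sym_op (iso_op d) s x y)" for x y
  define B where "B x y = (\<Sum>s\<in>labels n m. \<kappa> * \<beta> (card (fst s)) (card (snd s)) *
      labelled_op d n m (iso_op d) sym_op s x y)" for x y
  have coeff: "0 \<le> \<kappa> * \<alpha> (card (fst s)) (card (snd s))" "0 \<le> \<kappa> * \<beta> (card (fst s)) (card (snd s))"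
    if "s \<in> labels n m" for s
    using pos labels_card[OF that] \<kappa> by simp_all
  have "projection_cone (d ^ (n + m)) A"
    unfolding A_def[abs_def] using d coeff
    by (intro projection_cone_labelled_sum scaled_projection_sym_op scaled_projection_iso_op) auto
  moreover have "projection_cone (d ^ (n + m)) B"
    unfolding B_def[abs_def] using d coeff
    by (intro projection_cone_labelled_sum scaled_projection_sym_op scaled_projection_iso_op) auto
  moreover have "A x y + partial_transpose B x y = tensor_op d {..<n + m}
      (\<lambda>i. if i < m then partial_transpose (werner_op d p2) else werner_op d p1) x y" for x y
  proof -
    let ?L = "labelled_op d n m sym_op (\<lambda>a. partial_transpose (sym_op a))"
    have "A x y = \<kappa> * (\<Sum>s\<in>labels n m. \<alpha> (card (fst s)) (card (snd s)) *
        labelled_op d n m sym_op (\<lambda>b x y. \<Sum>a\<in>UNIV. label_coeff d a b * partial_transpose (sym_op a) x y) s x y)"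
      unfolding A_def sum_distrib_left mult.assoc iso_op_eq[OF d, abs_def] ..
    also have "\<dots> = \<kappa> * (\<Sum>s\<in>labels n m. (\<Sum>j<m + 1. V_mat d m $$ (card (snd s), j) * \<alpha> (card (fst s)) j) * ?L s x y)"
      unfolding labelled_sum_expand2[where f = \<alpha>] ..
    finally have A: "A x y = \<kappa> * (\<Sum>s\<in>labels n m.
        (\<Sum>j<m + 1. V_mat d m $$ (card (snd s), j) * \<alpha> (card (fst s)) j) * ?L s x y)" .
    have "partial_transpose B x y = \<kappa> * (\<Sum>s\<in>labels n m. \<beta> (card (fst s)) (card (snd s)) *
        partial_transpose (labelled_op d n m (iso_op d) sym_op s) x y)"
      unfolding B_def[abs_def] partial_transpose_def sum_distrib_left mult.assoc ..
    also have "\<dots> = \<kappa> * (\<Sum>s\<in>labels n m. \<beta> (card (fst s)) (card (snd s)) *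
        labelled_op d n m (\<lambda>b x y. \<Sum>a\<in>UNIV. label_coeff d a b * sym_op a x y)
          (\<lambda>a. partial_transpose (sym_op a)) s x y)"
      unfolding partial_transpose_labelled_op partial_transpose_iso_op[OF d] ..
    also have "\<dots> = \<kappa> * (\<Sum>s\<in>labels n m. (\<Sum>i<n + 1. V_mat d n $$ (card (fst s), i) * \<beta> i (card (snd s))) * ?L s x y)"
      unfolding labelled_sum_expand1[where f = \<beta>] ..
    finally have "A x y + partial_transpose B x y = \<kappa> * (\<Sum>s\<in>labels n m.
        ((\<Sum>j<m + 1. V_mat d m $$ (card (snd s), j) * \<alpha> (card (fst s)) j) +
         (\<Sum>i<n + 1. V_mat d n $$ (card (fst s), i) * \<beta> i (card (snd s)))) * ?L s x y)"
      unfolding A by (simp add: distrib_left distrib_right sum.distrib)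
    also have "\<dots> = \<kappa> * (\<Sum>s\<in>labels n m.
        v_vec d n p1 $ card (fst s) * v_vec d m p2 $ card (snd s) * ?L s x y)"
      by (intro arg_cong2[where f = "(*)"] sum.cong refl v[rule_format, symmetric] labels_card)
    finally show ?thesis unfolding werner_tensor_op[OF d] \<kappa>_def .
  qed
  ultimately show ?thesis
    using L choi by (intro decomposable_if_choi_op[where A = A and B = B]) simp_all
qed

lemma lp_nonneg_if_decomposable:
  assumes d: "2 \<le> d"
    and dec: "decomposable (d ^ (n + m)) (d ^ (n + m)) L"
    and choi: "\<And>x y. x \<in> square (d ^ (n + m)) \<Longrightarrow> y \<in> square (d ^ (n + m)) \<Longrightarrow>
      choi_op (d ^ (n + m)) L x y = complex_of_real (tensor_op d {..<n + m}
        (\<lambda>i. if i < m then partial_transpose (werner_op d p2) else werner_op d p1) x y)"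
  shows "0 \<le> lp_value d n m p1 p2"
  unfolding lp_value_nonneg_iff
proof
  let ?D = "d ^ (n + m)"
  let ?C = "tensor_op d {..<n + m} (\<lambda>i. if i < m then partial_transpose (werner_op d p2) else werner_op d p1)"
  fix Q assume "Q \<in> lp_feasible d n m"
  then have cone: "lp_cone d n m (\<lambda>k l. Q $$ (k, l))" by (simp add: lp_feasible_iff)
  define q where "q k l = Q $$ (k, l)" for k l
  obtain A B where A: "psd_op ?D ?D A" and B: "psd_op ?D ?D B"
    and AB: "\<forall>x\<in>square ?D. \<forall>y\<in>square ?D. choi_op ?D L x y = A x y + partial_transpose B x y"
    using decomposable_choi_op[OF dec] by (elim exE conjE)
  \<comment> \<open>The entries of \<open>q\<close> may be negative. Positivity appears only when
    the trailing sites of \<open>X\<close>, or the leading sites of its partial transpose, are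
    rewritten in \<open>iso_op\<close>: up to nonnegative factors the coefficients are then the
    constrained entries of \<open>Q V\<close> and of the transpose of \<open>Q\<close> times
    \<open>V\<close>.\<close>
  define X where "X x y = (\<Sum>s\<in>labels n m. q (card (fst s)) (card (snd s)) * label_weight n m s *
      labelled_op d n m (dual_sym_op d) (\<lambda>a. partial_transpose (dual_sym_op d a)) s x y)" for x y
  let ?H = "\<lambda>b x y. iso_weight d b * iso_op d b x y"
  have H: "scaled_projection d (?H b)" for b
    using d by (intro scaled_projection_scale scaled_projection_iso_op) (auto simp: iso_weight_def)
  have w: "0 \<le> label_weight n m s" for s by (simp add: label_weight_def)
  have "X = (\<lambda>x y. \<Sum>s\<in>labels n m. (\<Sum>l<m + 1. q (card (fst s)) l * V_mat d m $$ (l, card (snd s))) *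
      label_weight n m s * labelled_op d n m (dual_sym_op d) ?H s x y)"
    unfolding X_def[abs_def] partial_transpose_dual_sym_op[OF d] labelled_sum_expand_row2[where q = q and H = ?H] ..
  moreover have "0 \<le> (\<Sum>l<m + 1. q (card (fst s)) l * V_mat d m $$ (l, card (snd s))) * label_weight n m s"
    if "s \<in> labels n m" for s
    using cone labels_card[OF that] w unfolding lp_cone_def q_def by (intro mult_nonneg_nonneg) blast+
  ultimately have X: "projection_cone ?D X"
    using d H by (simp only:) (intro projection_cone_labelled_sum scaled_projection_dual_sym_op, auto)
  have swap: "partial_transpose (labelled_op d n m (dual_sym_op d) (\<lambda>a. partial_transpose (dual_sym_op d a)) s)
    = labelled_op d n m (\<lambda>a. partial_transpose (dual_sym_op d a)) (dual_sym_op d) s" for s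
    unfolding partial_transpose_labelled_op partial_transpose_partial_transpose ..
  have "partial_transpose X = (\<lambda>x y. \<Sum>s\<in>labels n m. q (card (fst s)) (card (snd s)) * label_weight n m s *
      partial_transpose (labelled_op d n m (dual_sym_op d) (\<lambda>a. partial_transpose (dual_sym_op d a)) s) x y)"
    unfolding X_def[abs_def] by (intro ext) (simp only: partial_transpose_def)
  also have "\<dots> = (\<lambda>x y. \<Sum>s\<in>labels n m. (\<Sum>k<n + 1. q k (card (snd s)) * V_mat d n $$ (k, card (fst s))) *
      label_weight n m s * labelled_op d n m ?H (dual_sym_op d) s x y)"
    unfolding swap unfolding partial_transpose_dual_sym_op[OF d] labelled_sum_expand_row1[where q = q and H = ?H] ..
  finally have "partial_transpose X = (\<lambda>x y. \<Sum>s\<in>labels n m.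
      (\<Sum>k<n + 1. q k (card (snd s)) * V_mat d n $$ (k, card (fst s))) *
      label_weight n m s * labelled_op d n m ?H (dual_sym_op d) s x y)" .
  moreover have "0 \<le> (\<Sum>k<n + 1. q k (card (snd s)) * V_mat d n $$ (k, card (fst s))) * label_weight n m s"
    if "s \<in> labels n m" for s
    using cone labels_card[OF that] w unfolding lp_cone_def q_def by (intro mult_nonneg_nonneg) blast+
  ultimately have XT: "projection_cone ?D (partial_transpose X)"
    using d H by (simp only:) (intro projection_cone_labelled_sum scaled_projection_dual_sym_op, auto)
  let ?c = "\<lambda>F x y. complex_of_real (F x y)"
  have "0 \<le> trace_pairing ?D (?c X) A + trace_pairing ?D (?c (partial_transpose X)) B"
    by (intro add_nonneg_nonneg trace_projection_cone_psd_nonneg X XT A B)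
  also have "?c (partial_transpose X) = partial_transpose (?c X)"
    by (intro ext) (simp add: partial_transpose_def)
  also have "trace_pairing ?D (?c X) A + trace_pairing ?D (partial_transpose (?c X)) B
    = trace_pairing ?D (?c X) (\<lambda>x y. A x y + partial_transpose B x y)"
    unfolding trace_pairing_partial_transpose trace_pairing_add_right ..
  also have "\<dots> = trace_pairing ?D (?c X) (?c ?C)"
    by (rule trace_pairing_cong) (use AB in \<open>simp_all add: choi[symmetric]\<close>)
  also have "\<dots> = complex_of_real (trace_pairing ?D X ?C)"
    by (rule trace_pairing_of_real)
  finally have "0 \<le> trace_pairing ?D X ?C" by (simp add: less_eq_complex_def)
  also have "trace_pairing ?D X ?C = (\<Sum>s\<in>labels n m. q (card (fst s)) (card (snd s)) * label_weight n m s *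
      (v_vec d n p1 $ card (fst s) * v_vec d m p2 $ card (snd s)))"
    unfolding X_def[abs_def] trace_pairing_sum_left
    by (intro sum.cong refl arg_cong2[where f = "(*)"] trace_labelled_op_werner[OF d])
  also have "\<dots> = (\<Sum>s\<in>labels n m. (\<lambda>k l. v_vec d n p1 $ k * v_vec d m p2 $ l * q k l)
      (card (fst s)) (card (snd s)) * label_weight n m s)"
    by (simp only: mult_ac)
  also have "\<dots> = lp_objective d n m p1 p2 q"
    unfolding sum_labels_weight[where q = "\<lambda>k l. v_vec d n p1 $ k * v_vec d m p2 $ l * q k l"] lp_objective_def ..
  finally show "0 \<le> lp_objective d n m p1 p2 (\<lambda>k l. Q $$ (k, l))"
    unfolding q_def[abs_def] .
qed

theorem theorem4p2:
  fixes d n m :: nat and p1 p2 :: real and W1 W2 :: "complex mat \<Rightarrow> complex mat"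
  assumes "d \<ge> 2"
    and "p1 \<in> {0..1}" and "p2 \<in> {0..1}"
    and "is_werner_map d p1 W1" and "is_werner_map d p2 W2"
  shows "decomposable (d ^ (n + m)) (d ^ (n + m))
      (tensor_map (d ^ n) (d ^ n) (tensor_power d W1 n)
         (d ^ m) (d ^ m) (tensor_power d (transpose_mat \<circ> W2) m))
    \<longleftrightarrow> 0 \<le> lp_value d n m p1 p2"
proof -
  let ?L = "tensor_map (d ^ n) (d ^ n) (tensor_power d W1 n)
         (d ^ m) (d ^ m) (tensor_power d (transpose_mat \<circ> W2) m)"
  have W: "linear_map d d W1" "linear_map d d W2"
    using assms(4,5) by (simp_all add: is_werner_map_def)
  have "linear_map (d ^ (n + m)) (d ^ (n + m)) ?L"
    unfolding power_add by (rule linear_map_tensor_map)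
  moreover have "choi_op (d ^ (n + m)) ?L x y = complex_of_real (tensor_op d {..<n + m}
      (\<lambda>i. if i < m then partial_transpose (werner_op d p2) else werner_op d p1) x y)"
    if "x \<in> square (d ^ (n + m))" "y \<in> square (d ^ (n + m))" for x y
  proof -
    have sq: "digit_pair d i x \<in> square d" for i x
      using assms(1) by (intro digit_pair_square) simp
    show ?thesis
      unfolding choi_op_tensor_powers[OF W(1) linear_map_transpose[OF W(2)] that] tensor_op_def of_real_prod
      using choi_op_werner(1)[OF assms(4) sq sq] choi_op_werner(2)[OF assms(5) sq sq]
      by (intro prod.cong refl) simp
  qed
  ultimately show ?thesis
    using decomposable_if_lp_nonneg[OF assms(1)] lp_nonneg_if_decomposable[OF assms(1)] by blast
qed

end
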